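(* Let $m_1,m_2,m_3>0$, let $\pi:\mathbb{C}^3\to\mathbb{R}^3$ be the shape map of the context, which identifies shape space with $\mathbb{R}^3$ (coordinates $w_1,w_2,w_3$), and let $$ds_{shape}^2=\frac{dw_1^2+dw_2^2+dw_3^2}{2\sqrt{w_1^2+w_2^2+w_3^2}}$$ be the shape space Riemannian metric. Then: (1) The distance function defined by the Riemannian metric $ds^2_{shape}$ agrees with the shape space distance $d([{\bf q}_1],[{\bf q}_2])=\inf_{g_1,g_2\in G}\|g_1{\bf q}_1-g_2{\bf q}_2\|$. (2) Its geodesics are the projections by $\pi:\mathbb{C}^3\to\mathbb{R}^3$ of horizontal lines in $\mathbb{C}^3$. (3) Each plane $\Pi:\ Aw_1+Bw_2+Cw_3=0$ through the origin is totally geodesic: a geodesic which starts on $\Pi$, initially tangent to $\Pi$, lies completely in the plane $\Pi$. (4) The restriction of the Riemannian metric to such a plane $\Pi$, when expressed in standard Euclidean polar coordinates $(r,\theta)$ on that plane, has the form $$ds^2_{shape}|_{\Pi}=dr^2+\tfrac14 r^2\,d\theta^2 .$$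
   Context: A located triangle is a vector ${\bf q}=(q_1,q_2,q_3)\in\mathbb{C}^3$. The Hermitian mass inner product on $\mathbb{C}^3$ is $\langle{\bf v},{\bf w}\rangle=\sum_i m_i\bar v_iw_i$, with norm $\|\cdot\|$; its real part is a real inner product on $\mathbb{C}^3\cong\mathbb{R}^6$. The group $G$ of rigid motions (orientation-preserving isometries) of the plane acts on $\mathbb{C}^3$ by ${\bf q}\mapsto e^{i\theta}{\bf q}+c(1,1,1)$, $\theta\in\mathbb{R}$, $c\in\mathbb{C}$. Shape space is the quotient $\mathbb{C}^3/G$, the space of oriented congruence classes of planar triangles; $[{\bf q}]$ is the class ($G$-orbit) of ${\bf q}$. The shape map is $\pi=\pi^{rot}\circ\pi_{tr}$ with $\pi_{tr}({\bf q})=(Z_1,Z_2)$, $Z_1=\mu_1(q_1-q_2)$, $Z_2=\mu_2\big(q_3-\frac{m_1q_1+m_2q_2}{m_1+m_2}\big)$, where $\mu_1,\mu_2>0$, $\frac1{\mu_1^2}=\frac1{m_1}+\frac1{m_2}$, $\frac1{\mu_2^2}=\frac1{m_3}+\frac1{m_1+m_2}$, and $\pi^{rot}(Z_1,Z_2)=\big(\tfrac12(|Z_1|^2-|Z_2|^2),\mathrm{Re}(Z_1\bar Z_2),\mathrm{Im}(Z_1\bar Z_2)\big)=(w_1,w_2,w_3)$. The map $\pi$ is onto, and two located triangles have the same image under $\pi$ if and only if they lie in the same $G$-orbit. The length of a path in shape space is $\int ds_{shape}$ along the path; the distance defined by the Riemannian metric between two points is the infimum of the lengths of all paths joining them, and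 a geodesic is a curve realizing this distance (a length minimizer). A vector based at ${\bf q}\in\mathbb{C}^3$ is horizontal if it is orthogonal, with respect to the real part of the mass inner product, to the tangent space at ${\bf q}$ of the $G$-orbit through ${\bf q}$. A horizontal line is a straight line in $\mathbb{C}^3$ whose tangent vector is horizontal at its points.
   Formalization: In (2) geodesics are locally length-minimizing curves, and in the converse triple collision may occur only at an end of the line; in (3) the initial velocity is nonzero; in (4) r is not the Euclidean radius R but r = sqrt(2R), since with r = R the formula fails. *)

theory Defs
  imports "HOL-Analysis.Analysis"
begin

section \<open>Located triangles, the mass metric and rigid motions\<close>

type_synonym triangle = "complex ^ 3"

definition mass_inner :: "real ^ 3 \<Rightarrow> triangle \<Rightarrow> triangle \<Rightarrow> complex" where
  "mass_inner m v w = (\<Sum>i\<in>UNIV. of_real (m $ i) * cnj (v $ i) * w $ i)"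

definition mass_norm :: "real ^ 3 \<Rightarrow> triangle \<Rightarrow> real" where
  "mass_norm m v = sqrt (Re (mass_inner m v v))"

definition rigid_motion :: "real \<Rightarrow> complex \<Rightarrow> triangle \<Rightarrow> triangle" where
  "rigid_motion \<theta> c q = (\<chi> i. cis \<theta> * q $ i + c)"

definition rigid_motions :: "(triangle \<Rightarrow> triangle) set" where
  "rigid_motions = {rigid_motion \<theta> c |\<theta> c. True}"

definition shape_class :: "triangle \<Rightarrow> triangle set" where
  "shape_class q = {g q |g. g \<in> rigid_motions}"

text \<open>The distance between the classes of two triangles, as a function of representatives.\<close>

definition shape_distance :: "real ^ 3 \<Rightarrow> triangle \<Rightarrow> triangle \<Rightarrow> real" where
  "shape_distance m q q' =
     (INF (g, g')\<in>rigid_motions \<times> rigid_motions. mass_norm m (g q - g' q'))"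

section \<open>The shape map\<close>

definition mu1 :: "real ^ 3 \<Rightarrow> real" where
  "mu1 m = 1 / sqrt (1 / m $ 1 + 1 / m $ 2)"

definition mu2 :: "real ^ 3 \<Rightarrow> real" where
  "mu2 m = 1 / sqrt (1 / m $ 3 + 1 / (m $ 1 + m $ 2))"

definition jacobi_map :: "real ^ 3 \<Rightarrow> triangle \<Rightarrow> complex \<times> complex" where
  "jacobi_map m q =
     (of_real (mu1 m) * (q $ 1 - q $ 2),
      of_real (mu2 m) *
        (q $ 3 - (of_real (m $ 1) * q $ 1 + of_real (m $ 2) * q $ 2) / of_real (m $ 1 + m $ 2)))"

definition rot_map :: "complex \<times> complex \<Rightarrow> real ^ 3" where
  "rot_map = (\<lambda>(z1, z2).
     vector [((cmod z1)\<^sup>2 - (cmod z2)\<^sup>2) / 2, Re (z1 * cnj z2), Im (z1 * cnj z2)])"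

definition shape_map :: "real ^ 3 \<Rightarrow> triangle \<Rightarrow> real ^ 3" where
  "shape_map m q = rot_map (jacobi_map m q)"

section \<open>The Riemannian metric on shape space and its length structure\<close>

text \<open>The quadratic form \<open>ds\<^sup>2\<close> at the point \<open>w\<close>, evaluated on the tangent vector \<open>u\<close>.\<close>

definition shape_metric :: "real ^ 3 \<Rightarrow> real ^ 3 \<Rightarrow> real" where
  "shape_metric w u = (norm u)\<^sup>2 / (2 * norm w)"

text \<open>
  Paths are continuous and \<open>C\<^sup>1\<close> off a finite set, and may pass through the singular point \<open>0\<close>
  (the triple collision), where \<open>shape_metric\<close> takes the junk value \<open>0\<close>. This does not affect
  lengths: for almost every parameter \<open>t\<close> with \<open>\<gamma> t = 0\<close> the velocity vanishes as well. Lengths may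
  be infinite.
\<close>

definition shape_length :: "(real \<Rightarrow> real ^ 3) \<Rightarrow> real \<Rightarrow> real \<Rightarrow> ennreal" where
  "shape_length \<gamma> a b =
     (\<integral>\<^sup>+t\<in>{a..b}. ennreal (sqrt (shape_metric (\<gamma> t) (vector_derivative \<gamma> (at t)))) \<partial>lborel)"

definition riemannian_distance :: "real ^ 3 \<Rightarrow> real ^ 3 \<Rightarrow> ennreal" where
  "riemannian_distance p p' =
     (INF \<gamma>\<in>{\<gamma>. valid_path \<gamma> \<and> pathstart \<gamma> = p \<and> pathfinish \<gamma> = p'}. shape_length \<gamma> 0 1)"

definition length_minimizer :: "(real \<Rightarrow> real ^ 3) \<Rightarrow> real \<Rightarrow> real \<Rightarrow> bool" where
  "length_minimizer \<gamma> a b \<longleftrightarrow>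
     \<gamma> piecewise_C1_differentiable_on {a..b} \<and>
     shape_length \<gamma> a b = riemannian_distance (\<gamma> a) (\<gamma> b)"

text \<open>
  Geodesics on an arbitrary interval are the curves all of whose sufficiently short arcs are
  length minimizers; in particular every length minimizer on \<open>{a..b}\<close> is a geodesic on \<open>{a..b}\<close>.
  The local condition cannot be replaced by the global one: a complete geodesic need not minimize
  length between far apart points. The parametrization is arbitrary and may pause, and therefore
  shortness of an arc is measured by its length and not by the parameter (so that a curve pausing
  at a corner is not a geodesic).
\<close>

definition geodesic_on :: "real set \<Rightarrow> (real \<Rightarrow> real ^ 3) \<Rightarrow> bool" where
  "geodesic_on I \<gamma> \<longleftrightarrow>
     is_interval I \<and>
     (\<forall>a b. a \<le> b \<and> {a..b} \<subseteq> I \<longrightarrow>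
        \<gamma> piecewise_C1_differentiable_on {a..b} \<and> shape_length \<gamma> a b < \<infinity>) \<and>
     (\<forall>t\<in>I. \<exists>\<epsilon>>0. \<forall>a b. a \<le> t \<and> t \<le> b \<and> {a..b} \<subseteq> I \<and> shape_length \<gamma> a b < \<epsilon> \<longrightarrow>
        length_minimizer \<gamma> a b)"

section \<open>Horizontal lines\<close>

text \<open>Tangent vectors to the orbit through \<open>q\<close> are the velocities at \<open>q\<close> of curves in the orbit.\<close>

definition orbit_tangent_space :: "triangle \<Rightarrow> triangle set" where
  "orbit_tangent_space q =
     {u. \<exists>c :: real \<Rightarrow> triangle. c 0 = q \<and> (\<forall>t. c t \<in> shape_class q) \<and>
           (c has_vector_derivative u) (at 0)}"

definition horizontal :: "real ^ 3 \<Rightarrow> triangle \<Rightarrow> triangle \<Rightarrow> bool" where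
  "horizontal m q v \<longleftrightarrow> (\<forall>u\<in>orbit_tangent_space q. Re (mass_inner m v u) = 0)"

text \<open>The line \<open>t \<mapsto> q + t v\<close>.\<close>

definition horizontal_line :: "real ^ 3 \<Rightarrow> triangle \<Rightarrow> triangle \<Rightarrow> bool" where
  "horizontal_line m q v \<longleftrightarrow> v \<noteq> 0 \<and> (\<forall>t::real. horizontal m (q + t *\<^sub>R v) v)"

section \<open>Planes through the origin\<close>

definition origin_plane :: "real \<Rightarrow> real \<Rightarrow> real \<Rightarrow> (real ^ 3) set" where
  "origin_plane A B C = {w. A * w $ 1 + B * w $ 2 + C * w $ 3 = 0}"

text \<open>
  Standard polar coordinates with respect to an orthonormal basis \<open>e1, e2\<close> of a plane; \<open>R\<close> is the
  Euclidean distance from the origin. The radial coordinate \<open>r\<close> for which the metric has the form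
  \<open>dr\<^sup>2 + r\<^sup>2 d\<theta>\<^sup>2 / 4\<close> is the mass norm of the centred triangle, that is \<open>R = r\<^sup>2 / 2\<close>. In terms of
  \<open>R\<close> the metric is \<open>(dR\<^sup>2 + R\<^sup>2 d\<theta>\<^sup>2) / (2 R)\<close>.
\<close>

definition plane_polar :: "real ^ 3 \<Rightarrow> real ^ 3 \<Rightarrow> real \<Rightarrow> real \<Rightarrow> real ^ 3" where
  "plane_polar e1 e2 R \<theta> = R *\<^sub>R (cos \<theta> *\<^sub>R e1 + sin \<theta> *\<^sub>R e2)"

end

theory Submission
  imports Defs
begin

text \<open>
  Jacobi coordinates turn the triangles modulo translations, with the mass norm, into the
  Hermitian space \<open>\<complex>\<^sup>2\<close>. What remains is the quotient of \<open>\<complex>\<^sup>2\<close> by the unit circle, which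
  \<open>rot_map\<close> identifies with \<open>\<real>\<^sup>3\<close>: it is the Hopf map, homogeneous of degree two, with
  \<open>\<bar>rot_map Z\<bar> = \<bar>Z\<bar>\<^sup>2 / 2\<close>. A vector \<open>V\<close> at \<open>Z\<close> is horizontal when the Hermitian product
  \<open>\<langle>Z, V\<rangle>\<close> is real, and the derivative of \<open>rot_map\<close> multiplies the length of such vectors by
  \<open>\<bar>Z\<bar> = sqrt (2 \<bar>w\<bar>)\<close> (\<open>norm_rot_polar\<close>). This is exactly the conformal factor of the shape
  metric, so the shape metric is the quotient metric.

  Distance. The square of the distance between the circle orbits of \<open>Z\<close> and \<open>W\<close> is
  \<open>\<bar>Z\<bar>\<^sup>2 + \<bar>W\<bar>\<^sup>2 - 2 \<bar>\<langle>Z, W\<rangle>\<bar>\<close>, and \<open>\<bar>\<langle>Z, W\<rangle>\<bar>\<close> depends only on the images of \<open>Z\<close> and \<open>W\<close> in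
  \<open>\<real>\<^sup>3\<close>. This gives the closed formula \<open>quotient_dist\<close> on \<open>\<real>\<^sup>3\<close>, a metric since orbits can be
  aligned by rotations. Two points of \<open>\<real>\<^sup>3\<close> are joined by the projection of the segment between
  aligned lifts, whose length is the Euclidean one (\<open>shape_length_projected_line\<close>). Conversely,
  \<open>quotient_dist w w'\<close> is asymptotic to \<open>\<bar>w - w'\<bar> / sqrt (2 \<bar>w\<bar>)\<close> near a point \<open>w \<noteq> 0\<close>, so with
  the triangle inequality it is bounded by the length of every path
  (\<open>quotient_dist_le_integral_speed\<close>).

  Geodesics. A short arc of a geodesic, parametrised by arc length, is isometric to an interval
  for \<open>quotient_dist\<close>. Choose aligned lifts of its points one after the other: equality in the
  triangle inequality puts them on one line of \<open>\<complex>\<^sup>2\<close>, and this line is horizontal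
  (\<open>isometric_arc_is_projected_line\<close>). The projection of a line is a quadratic polynomial, hence
  determined by any nontrivial arc, so that the local lines fit together to a single one.
  Conversely, two points of a horizontal line are aligned when their Hermitian product is
  nonnegative, which holds for nearby points as long as the line does not run through the origin
  between them.

  Planes. For a horizontal line \<open>Z + s V\<close> the images of \<open>Z\<close> and \<open>V\<close> and the initial velocity of
  the projected line are linearly dependent (\<open>rot_map_coplanar\<close>). If \<open>Z \<noteq> 0\<close>, the projected line
  therefore lies in the span of its starting point and its initial velocity; if \<open>Z = 0\<close>, it lies
  on a ray.
\<close>

section \<open>The Hopf map and the distance between circle orbits\<close>

definition herm :: "complex \<times> complex \<Rightarrow> complex \<times> complex \<Rightarrow> complex" where
  "herm Z W = fst Z * cnj (fst W) + snd Z * cnj (snd W)"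

definition phase :: "complex \<Rightarrow> complex \<times> complex \<Rightarrow> complex \<times> complex" where
  "phase u Z = (u * fst Z, u * snd Z)"

text \<open>
  The polarisation of the quadratic map \<open>rot_map\<close>; \<open>rot_polar Z V\<close> is the derivative of
  \<open>rot_map\<close> at \<open>Z\<close> in the direction \<open>V\<close>.
\<close>

definition rot_polar :: "complex \<times> complex \<Rightarrow> complex \<times> complex \<Rightarrow> real ^ 3" where
  "rot_polar Z V = vector [Re (fst Z * cnj (fst V)) - Re (snd Z * cnj (snd V)),
     Re (fst Z * cnj (snd V) + fst V * cnj (snd Z)), Im (fst Z * cnj (snd V) + fst V * cnj (snd
         Z))]"

text \<open>
  The distance between the circle orbits above two points of \<open>\<real>\<^sup>3\<close>, in a form that does not
  refer to lifts. The inner square root is the modulus of the Hermitian product of any two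
  lifts.
\<close>

definition quotient_dist :: "real ^ 3 \<Rightarrow> real ^ 3 \<Rightarrow> real" where
  "quotient_dist w w' =
     sqrt (2 * ((norm w + norm w') - sqrt ((norm w + norm w')\<^sup>2 - (norm (w - w'))\<^sup>2)))"

lemma norm_vec3_sq: "(norm (w :: real ^ 3))\<^sup>2 = (w $ 1)\<^sup>2 + (w $ 2)\<^sup>2 + (w $ 3)\<^sup>2"
  unfolding power2_norm_eq_inner inner_vec_def sum_3 by (simp add: power2_eq_square)

lemma norm_pair_sq: "(norm (Z :: complex \<times> complex))\<^sup>2
    = (Re (fst Z))\<^sup>2 + (Im (fst Z))\<^sup>2 + (Re (snd Z))\<^sup>2 + (Im (snd Z))\<^sup>2"
  by (cases Z) (simp add: norm_Pair cmod_power2)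

lemma rot_map_components:
  "rot_map Z $ 1 = ((cmod (fst Z))\<^sup>2 - (cmod (snd Z))\<^sup>2) / 2"
  "rot_map Z $ 2 = Re (fst Z * cnj (snd Z))"
  "rot_map Z $ 3 = Im (fst Z * cnj (snd Z))"
  by (simp_all add: rot_map_def case_prod_beta)

lemma rot_polar_components:
  "rot_polar Z V $ 1 = Re (fst Z * cnj (fst V)) - Re (snd Z * cnj (snd V))"
  "rot_polar Z V $ 2 = Re (fst Z * cnj (snd V) + fst V * cnj (snd Z))"
  "rot_polar Z V $ 3 = Im (fst Z * cnj (snd V) + fst V * cnj (snd Z))"
  by (simp_all add: rot_polar_def)

lemma herm_self: "herm Z Z = of_real ((norm Z)\<^sup>2)"
  unfolding norm_pair_sq by (simp add: herm_def complex_eq_iff power2_eq_square)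

lemma herm_add_right: "herm Z (V + W) = herm Z V + herm Z W"
  by (simp add: herm_def algebra_simps)

lemma herm_add_left: "herm (V + W) Z = herm V Z + herm W Z"
  by (simp add: herm_def algebra_simps)

lemma herm_scale_right: "herm Z (s *\<^sub>R V) = of_real s * herm Z V"
  by (simp add: herm_def scaleR_conv_of_real algebra_simps)

lemma herm_scale_left: "herm (s *\<^sub>R V) Z = of_real s * herm V Z"
  by (simp add: herm_def scaleR_conv_of_real algebra_simps)

lemma herm_cnj: "herm W Z = cnj (herm Z W)"
  by (simp add: herm_def)

lemma herm_phase_left: "herm (phase u Z) W = u * herm Z W"
  by (simp add: herm_def phase_def algebra_simps)

lemma herm_phase_right: "herm Z (phase u W) = cnj u * herm Z W"
  by (simp add: herm_def phase_def algebra_simps)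

lemma phase_1 [simp]: "phase 1 Z = Z"
  by (simp add: phase_def)

lemma rot_map_phase:
  assumes "cmod u = 1" shows "rot_map (phase u Z) = rot_map Z"
proof -
  have "u * a * cnj (u * b) = a * cnj b" for a b
  proof -
    have "u * a * cnj (u * b) = (u * cnj u) * (a * cnj b)" by simp
    then show ?thesis using assms by (simp add: complex_mult_cnj cmod_power2[symmetric])
  qed
  then show ?thesis
    unfolding rot_map_def phase_def case_prod_beta fst_conv snd_conv
    using assms by (simp only: norm_mult mult_1)
qed

lemma norm_diff_sq_herm: "(norm (Z - W))\<^sup>2 = (norm Z)\<^sup>2 + (norm W)\<^sup>2 - 2 * Re (herm Z W)"
  unfolding norm_pair_sq by (simp add: herm_def power2_eq_square algebra_simps)

lemma norm_rot_map: "norm (rot_map Z) = (norm Z)\<^sup>2 / 2"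
proof -
  have "(norm (rot_map Z))\<^sup>2 = ((norm Z)\<^sup>2 / 2)\<^sup>2"
    unfolding norm_vec3_sq rot_map_components norm_pair_sq cmod_power2
    by (simp add: power2_eq_square algebra_simps add_divide_distrib diff_divide_distrib)
  then show ?thesis by (rule power2_eq_imp_eq) simp_all
qed

lemma rot_map_eq_0_iff: "rot_map Z = 0 \<longleftrightarrow> Z = 0"
  using norm_eq_zero[of "rot_map Z"] unfolding norm_rot_map by simp

text \<open>
  This is Cauchy-Schwarz with its defect made explicit. It shows that the images of two vectors
  determine their Hermitian product up to a phase.
\<close>

lemma herm_norm_sq_rot_map:
  "(norm (rot_map Z) + norm (rot_map W))\<^sup>2 - (norm (rot_map Z - rot_map W))\<^sup>2 = (cmod (herm Z W))\<^sup>2"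
  unfolding norm_rot_map norm_vec3_sq vector_minus_component rot_map_components norm_pair_sq
    cmod_power2 herm_def
  by (simp add: power2_eq_square field_simps)

lemma quotient_dist_rot_map_sq:
  "(quotient_dist (rot_map Z) (rot_map W))\<^sup>2 = (norm Z)\<^sup>2 + (norm W)\<^sup>2 - 2 * cmod (herm Z W)"
proof -
  have "cmod (herm Z W) \<le> norm (rot_map Z) + norm (rot_map W)"
  proof (rule power2_le_imp_le)
    show "(cmod (herm Z W))\<^sup>2 \<le> (norm (rot_map Z) + norm (rot_map W))\<^sup>2"
      by (simp flip: herm_norm_sq_rot_map)
  qed simp
  then show ?thesis
    unfolding quotient_dist_def herm_norm_sq_rot_map
    by (simp add: norm_rot_map)
qed

lemma quotient_dist_nonneg: "quotient_dist w w' \<ge> 0"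
proof -
  have "sqrt ((norm w + norm w')\<^sup>2 - (norm (w - w'))\<^sup>2) \<le> sqrt ((norm w + norm w')\<^sup>2)"
    by (intro real_sqrt_le_mono) simp
  then show ?thesis by (simp add: quotient_dist_def)
qed

lemma quotient_dist_commute: "quotient_dist w w' = quotient_dist w' w"
  by (simp add: quotient_dist_def norm_minus_commute add.commute)

lemma quotient_dist_le_norm: "quotient_dist (rot_map Z) (rot_map W) \<le> norm (Z - W)"
proof (rule power2_le_imp_le)
  show "(quotient_dist (rot_map Z) (rot_map W))\<^sup>2 \<le> (norm (Z - W))\<^sup>2"
    unfolding quotient_dist_rot_map_sq norm_diff_sq_herm using complex_Re_le_cmod[of "herm Z W"]
        by simp
qed simp

text \<open>
  Two vectors realise the distance of their orbits exactly when no rotation of one of them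
  increases the real part of their Hermitian product.
\<close>

lemma quotient_dist_eq_norm_iff:
  "quotient_dist (rot_map Z) (rot_map W) = norm (Z - W) \<longleftrightarrow> herm Z W = of_real (cmod (herm Z W))"
proof -
  have "quotient_dist (rot_map Z) (rot_map W) = norm (Z - W)
      \<longleftrightarrow> (quotient_dist (rot_map Z) (rot_map W))\<^sup>2 = (norm (Z - W))\<^sup>2"
    by (rule power2_eq_iff_nonneg[OF quotient_dist_nonneg norm_ge_zero, symmetric])
  also have "\<dots> \<longleftrightarrow> Re (herm Z W) = cmod (herm Z W)"
    unfolding quotient_dist_rot_map_sq norm_diff_sq_herm by auto
  also have "\<dots> \<longleftrightarrow> herm Z W = of_real (cmod (herm Z W))"
    using cmod_power2[of "herm Z W"] by (auto simp: complex_eq_iff)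
  finally show ?thesis .
qed

lemma ex_unit_phase: "\<exists>u. cmod u = 1 \<and> cnj u * z = of_real (cmod z)"
proof (cases "z = 0")
  case True then show ?thesis by (intro exI[of _ 1]) simp
next
  case False
  have "cnj (sgn z) * z = of_real (cmod z)"
    using False
    by (simp add: sgn_eq mult.commute[of "cnj z"] complex_norm_square[symmetric] power2_eq_square)
  moreover have "cmod (sgn z) = 1" using False by (simp add: norm_sgn)
  ultimately show ?thesis by blast
qed

lemma ex_aligned_phase:
  "\<exists>u. cmod u = 1 \<and> norm (Z - phase u W) = quotient_dist (rot_map Z) (rot_map W)"
proof -
  obtain u where u: "cmod u = 1" "cnj u * herm Z W = of_real (cmod (herm Z W))"
    using ex_unit_phase by blast
  have "herm Z (phase u W) = of_real (cmod (herm Z (phase u W)))"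
    using u by (simp add: herm_phase_right norm_mult)
  then have "quotient_dist (rot_map Z) (rot_map (phase u W)) = norm (Z - phase u W)"
    by (simp add: quotient_dist_eq_norm_iff)
  with u show ?thesis by (auto simp: rot_map_phase)
qed

lemma quotient_dist_eq_0_iff: "quotient_dist w w' = 0 \<longleftrightarrow> w = w'"
proof
  assume "quotient_dist w w' = 0"
  then have "norm w + norm w' = sqrt ((norm w + norm w')\<^sup>2 - (norm (w - w'))\<^sup>2)"
    by (simp add: quotient_dist_def)
  moreover have "(norm (w - w'))\<^sup>2 \<le> (norm w + norm w')\<^sup>2"
    by (intro power_mono norm_triangle_ineq4) simp
  ultimately have "(norm w + norm w')\<^sup>2 = (norm w + norm w')\<^sup>2 - (norm (w - w'))\<^sup>2"
    by (metis diff_ge_0_iff_ge real_sqrt_pow2)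
  then show "w = w'" by simp
qed (simp add: quotient_dist_def real_sqrt_mult)

lemma rot_map_eq_iff: "rot_map Z = rot_map W \<longleftrightarrow> (\<exists>u. cmod u = 1 \<and> Z = phase u W)"
  using ex_aligned_phase[of Z W] quotient_dist_eq_0_iff[of "rot_map Z" "rot_map W"]
  by (auto simp: rot_map_phase)

text \<open>
  Rotate a lift so that its first coordinate is positive; its modulus is then forced to be
  \<open>sqrt (\<bar>w\<bar> + w\<^sub>1)\<close>, and the second coordinate follows by division. On the half line where this
  modulus vanishes the second coordinate alone carries the point.
\<close>

lemma rot_map_surj: "\<exists>Z. rot_map Z = w"
proof (cases "norm w + w $ 1 = 0")
  case True
  have "(w $ 2)\<^sup>2 + (w $ 3)\<^sup>2 = 0"
    using norm_vec3_sq[of w] True by (simp add: add_eq_0_iff)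
  then have "w $ 2 = 0" "w $ 3 = 0" by (simp_all add: sum_power2_eq_zero_iff)
  moreover have "rot_map (0, of_real (sqrt (2 * norm w))) $ 1 = - norm w"
    by (simp add: rot_map_components)
  ultimately have "rot_map (0, of_real (sqrt (2 * norm w))) = w"
    using True by (simp add: vec_eq_iff forall_3 rot_map_components)
  then show ?thesis by blast
next
  case False
  define R where "R = norm w + w $ 1"
  have "\<bar>w $ 1\<bar> \<le> norm w" by (rule component_le_norm_cart)
  then have R: "R > 0" using False by (simp add: R_def)
  have *: "(w $ 2)\<^sup>2 + (w $ 3)\<^sup>2 = R * (norm w - w $ 1)"
    using norm_vec3_sq[of w] by (simp add: R_def power2_eq_square algebra_simps)
  let ?Z = "(of_real (sqrt R), Complex (w $ 2) (- w $ 3) / of_real (sqrt R))"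
  have "(cmod (Complex (w $ 2) (- w $ 3)))\<^sup>2 = R * (norm w - w $ 1)"
    using * by (simp add: cmod_power2)
  then have "rot_map ?Z $ 1 = w $ 1"
    using R by (simp add: rot_map_components norm_divide power_divide) (simp add: R_def)
  moreover have "rot_map ?Z $ 2 = w $ 2" "rot_map ?Z $ 3 = w $ 3"
    using R by (simp_all add: rot_map_components Re_divide_of_real Im_divide_of_real)
  ultimately have "rot_map ?Z = w" by (simp add: vec_eq_iff forall_3)
  then show ?thesis by blast
qed

lemma ex_aligned_lift:
  "\<exists>W. rot_map W = w \<and> norm (Z - W) = quotient_dist (rot_map Z) w"
proof -
  obtain W where W: "rot_map W = w" using rot_map_surj by blast
  obtain u where "cmod u = 1" "norm (Z - phase u W) = quotient_dist (rot_map Z) (rot_map W)"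
    using ex_aligned_phase by blast
  with W show ?thesis by (intro exI[of _ "phase u W"]) (simp add: rot_map_phase)
qed

lemma quotient_dist_triangle: "quotient_dist p r \<le> quotient_dist p q + quotient_dist q r"
proof -
  obtain X where X: "rot_map X = p" using rot_map_surj by blast
  obtain Y where Y: "rot_map Y = q" "norm (X - Y) = quotient_dist p q"
    using ex_aligned_lift[of q X] X by auto
  obtain Z where Z: "rot_map Z = r" "norm (Y - Z) = quotient_dist q r"
    using ex_aligned_lift[of r Y] Y by auto
  have "quotient_dist p r \<le> norm (X - Z)" using quotient_dist_le_norm[of X Z] X Z by simp
  also have "\<dots> \<le> norm (X - Y) + norm (Y - Z)" using norm_triangle_ineq[of "X - Y" "Y - Z"] by simp
  finally show ?thesis using Y Z by simp
qed

lemma rot_map_line: "rot_map (Z + s *\<^sub>R V) = rot_map Z + s *\<^sub>R rot_polar Z V + s\<^sup>2 *\<^sub>R rot_map V"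
  unfolding vec_eq_iff forall_3 vector_add_component vector_scaleR_component rot_map_components
    rot_polar_components cmod_power2
  by (simp add: power2_eq_square field_simps)

text \<open>
  The modulus and the imaginary part of the Hermitian product split Cauchy-Schwarz between the
  derivative of \<open>rot_map\<close> and the vertical part of \<open>V\<close>. On horizontal vectors \<open>rot_map\<close> is
  therefore conformal with factor \<open>\<bar>Z\<bar>\<close>.
\<close>

lemma norm_rot_polar:
  assumes "Im (herm Z V) = 0" shows "norm (rot_polar Z V) = norm Z * norm V"
proof -
  have "(norm (rot_polar Z V))\<^sup>2 + (Im (herm Z V))\<^sup>2 = (norm Z)\<^sup>2 * (norm V)\<^sup>2"
    unfolding norm_vec3_sq norm_pair_sq rot_polar_components herm_def
    by (simp add: power2_eq_square algebra_simps)
  then have "(norm (rot_polar Z V))\<^sup>2 = (norm Z * norm V)\<^sup>2"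
    using assms by (simp add: power_mult_distrib)
  then show ?thesis by (rule power2_eq_imp_eq) simp_all
qed

lemma rot_polar_scale_left: "rot_polar (Z + s *\<^sub>R V) V = rot_polar Z V + (2 * s) *\<^sub>R rot_map V"
  unfolding vec_eq_iff forall_3 vector_add_component vector_scaleR_component rot_map_components
    rot_polar_components cmod_power2
  by (simp add: power2_eq_square field_simps)

text \<open>
  If \<open>X\<close> is the component of \<open>V\<close> orthogonal to \<open>Z \<noteq> 0\<close>, then the images of \<open>X\<close> and \<open>Z\<close> lie on
  opposite rays. Hence for real \<open>\<langle>Z, V\<rangle>\<close> the image of \<open>V\<close> is a combination of the image of \<open>Z\<close>
  and of the derivative at \<open>Z\<close> along \<open>V\<close>.
\<close>

lemma rot_map_coplanar:
  assumes "Im (herm Z V) = 0"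
  shows "(norm Z)\<^sup>2 *\<^sub>R rot_map V + (norm V)\<^sup>2 *\<^sub>R rot_map Z = Re (herm Z V) *\<^sub>R rot_polar Z V"
proof -
  have "((norm Z)\<^sup>2 *\<^sub>R rot_map V + (norm V)\<^sup>2 *\<^sub>R rot_map Z) $ 1
      = (Re (herm Z V) *\<^sub>R rot_polar Z V) $ 1
        + Im (herm Z V) * (Im (fst Z * cnj (fst V)) - Im (snd Z * cnj (snd V)))"
    "((norm Z)\<^sup>2 *\<^sub>R rot_map V + (norm V)\<^sup>2 *\<^sub>R rot_map Z) $ 2
      = (Re (herm Z V) *\<^sub>R rot_polar Z V) $ 2
        - Im (herm Z V) * Im (fst V * cnj (snd Z) - fst Z * cnj (snd V))"
    "((norm Z)\<^sup>2 *\<^sub>R rot_map V + (norm V)\<^sup>2 *\<^sub>R rot_map Z) $ 3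
      = (Re (herm Z V) *\<^sub>R rot_polar Z V) $ 3
        + Im (herm Z V) * Re (fst V * cnj (snd Z) - fst Z * cnj (snd V))"
    unfolding vector_add_component vector_scaleR_component rot_map_components
      rot_polar_components norm_pair_sq cmod_power2 herm_def
    by (simp_all add: power2_eq_square field_simps)
  then show ?thesis
    unfolding vec_eq_iff forall_3 assms by (simp only: mult_zero_left add_0_right diff_0_right)
qed

section \<open>Jacobi coordinates and horizontal lines\<close>

definition moment :: "real ^ 3 \<Rightarrow> triangle \<Rightarrow> complex" where
  "moment m v = (\<Sum>i\<in>UNIV. of_real (m $ i) * v $ i)"

lemma shape_map_eq: "shape_map m q = rot_map (jacobi_map m q)"
  by (simp add: shape_map_def)

lemma jacobi_map_line: "jacobi_map m (q + t *\<^sub>R v) = jacobi_map m q + t *\<^sub>R jacobi_map m v"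
  by (simp add: jacobi_map_def scaleR_conv_of_real[where 'a=complex] add_divide_distrib
      diff_divide_distrib algebra_simps)

lemma jacobi_map_diff: "jacobi_map m (q - q') = jacobi_map m q - jacobi_map m q'"
  using jacobi_map_line[of m q "-1" q'] by simp

lemma moment_line: "moment m (q + t *\<^sub>R v) = moment m q + t *\<^sub>R moment m v"
  by (simp add: moment_def sum_3 scaleR_conv_of_real[where 'a=complex] algebra_simps)

lemma moment_diff: "moment m (q - q') = moment m q - moment m q'"
  using moment_line[of m q "-1" q'] by simp

lemma moment_rigid_motion:
  "moment m (rigid_motion \<theta> c q) = cis \<theta> * moment m q + of_real (m $ 1 + m $ 2 + m $ 3) * c"
  by (simp add: moment_def rigid_motion_def sum_3 algebra_simps)

text \<open>
  The reduction to the centre of mass, done first for the bodies 1 and 2 and then for their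
  centre of mass together with body 3. The bilinear form serves for the norm and for
  horizontality. The first coefficient is \<open>mu1\<^sup>2\<close> and the second is \<open>mu2\<^sup>2\<close>.
\<close>

lemma lagrange_identity_two_step:
  fixes m1 m2 m3 :: "'a :: field"
  assumes "m1 + m2 \<noteq> 0" "m1 + m2 + m3 \<noteq> 0"
  shows "m1 * a1 * b1 + m2 * a2 * b2 + m3 * a3 * b3 =
     (m1 * m2 / (m1 + m2)) * ((b1 - b2) * (a1 - a2))
   + (m3 * (m1 + m2) / (m1 + m2 + m3)) *
       ((b3 - (m1 * b1 + m2 * b2) / (m1 + m2)) * (a3 - (m1 * a1 + m2 * a2) / (m1 + m2)))
   + (m1 * b1 + m2 * b2 + m3 * b3) * (m1 * a1 + m2 * a2 + m3 * a3) / (m1 + m2 + m3)"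
proof -
  define p M where "p = m1 + m2" and "M = m1 + m2 + m3"
  have m: "m2 = p - m1" "m3 = M - p" by (simp_all add: p_def M_def)
  have "p \<noteq> 0" "M \<noteq> 0" using assms by (simp_all add: p_def M_def)
  then show ?thesis
    unfolding p_def[symmetric] M_def[symmetric] unfolding m
    by (simp add: divide_simps) algebra
qed

context
  fixes m :: "real ^ 3"
  assumes m_pos: "m $ 1 > 0" "m $ 2 > 0" "m $ 3 > 0"
begin

lemma mu1_sq: "(mu1 m)\<^sup>2 = m $ 1 * m $ 2 / (m $ 1 + m $ 2)"
  using m_pos by (simp add: mu1_def power_divide field_simps)

lemma mu2_sq: "(mu2 m)\<^sup>2 = m $ 3 * (m $ 1 + m $ 2) / (m $ 1 + m $ 2 + m $ 3)"
  using m_pos by (simp add: mu2_def power_divide field_simps)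

lemma mu_pos: "mu1 m > 0" "mu2 m > 0"
  using m_pos by (simp_all add: mu1_def mu2_def add_pos_pos)

lemma jacobi_map_rigid_motion:
  "jacobi_map m (rigid_motion \<theta> c q) = phase (cis \<theta>) (jacobi_map m q)"
proof -
  have "complex_of_real (m $ 1) + complex_of_real (m $ 2) \<noteq> 0"
    using m_pos by (metis add_pos_pos less_irrefl of_real_add of_real_eq_0_iff)
  then show ?thesis
    by (simp add: jacobi_map_def rigid_motion_def phase_def field_simps)
qed

lemma mass_inner_jacobi:
  "mass_inner m v w = herm (jacobi_map m w) (jacobi_map m v)
     + moment m w * cnj (moment m v) / of_real (m $ 1 + m $ 2 + m $ 3)"
proof -
  have nz: "complex_of_real (m $ 1) + complex_of_real (m $ 2) \<noteq> 0"
     "complex_of_real (m $ 1) + complex_of_real (m $ 2) + complex_of_real (m $ 3) \<noteq> 0"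
    using m_pos by (metis add_pos_pos less_irrefl of_real_add of_real_eq_0_iff)+
  have mu: "complex_of_real (mu1 m) * complex_of_real (mu1 m)
      = of_real (m $ 1) * of_real (m $ 2) / (of_real (m $ 1) + of_real (m $ 2))"
    "complex_of_real (mu2 m) * complex_of_real (mu2 m)
      = of_real (m $ 3) * (of_real (m $ 1) + of_real (m $ 2))
         / (of_real (m $ 1) + of_real (m $ 2) + of_real (m $ 3))"
    unfolding power2_eq_square[symmetric] of_real_power[symmetric] mu1_sq mu2_sq
    by (simp_all only: of_real_add of_real_mult of_real_divide)
  have herm: "herm (jacobi_map m w) (jacobi_map m v) =
     (of_real (mu1 m) * of_real (mu1 m)) * ((w $ 1 - w $ 2) * (cnj (v $ 1) - cnj (v $ 2)))
     + (of_real (mu2 m) * of_real (mu2 m)) *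
      ((w $ 3 - (of_real (m $ 1) * w $ 1 + of_real (m $ 2) * w $ 2) / (of_real (m $ 1) + of_real (m
          $ 2)))
      * (cnj (v $ 3) - (of_real (m $ 1) * cnj (v $ 1) + of_real (m $ 2) * cnj (v $ 2))
          / (of_real (m $ 1) + of_real (m $ 2))))"
    by (simp add: herm_def jacobi_map_def mult_ac)
  show ?thesis
    unfolding herm mu
    using lagrange_identity_two_step[OF nz, of "cnj (v $ 1)" "w $ 1" "cnj (v $ 2)" "w $ 2"
        "cnj (v $ 3)" "w $ 3"]
    by (simp add: mass_inner_def moment_def sum_3)
qed

lemma mass_norm_jacobi:
  "mass_norm m v = sqrt ((norm (jacobi_map m v))\<^sup>2 + (cmod (moment m v))\<^sup>2 / (m $ 1 + m $ 2 + m $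
      3))"
proof -
  have "moment m v * cnj (moment m v) / of_real (m $ 1 + m $ 2 + m $ 3)
      = of_real ((cmod (moment m v))\<^sup>2 / (m $ 1 + m $ 2 + m $ 3))"
    by (simp only: complex_norm_square of_real_divide)
  then show ?thesis
    unfolding mass_norm_def mass_inner_jacobi herm_self
        by (simp only: Re_complex_of_real of_real_add[symmetric])
qed

text \<open>
  Translations are best used to move both centres of mass to the origin, where the mass norm is
  the norm of the Jacobi coordinates; the rotations are then the phases of the orbit distance.
\<close>

lemma shape_distance_eq:
  "shape_distance m q q' = quotient_dist (shape_map m q) (shape_map m q')"
  unfolding shape_distance_def
proof (rule cInf_eq_minimum)
  let ?M = "m $ 1 + m $ 2 + m $ 3"
  have M: "?M > 0" using m_pos by simp
  obtain u where u: "cmod u = 1"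
    "norm (jacobi_map m q - phase u (jacobi_map m q')) = quotient_dist (shape_map m q) (shape_map m
        q')"
    using ex_aligned_phase unfolding shape_map_eq by blast
  obtain \<theta> where \<theta>: "cis \<theta> = u"
    using u(1) cis_Arg[of u] by (metis norm_zero sgn_eq div_by_1 of_real_1 zero_neq_one)
  let ?g = "rigid_motion 0 (- moment m q / of_real ?M)"
  let ?g' = "rigid_motion \<theta> (- cis \<theta> * moment m q' / of_real ?M)"
  have "moment m (?g q - ?g' q') = 0"
    using M by (simp only: moment_diff moment_rigid_motion) (simp add: less_imp_neq[OF M, symmetric]
        del: of_real_add)
  moreover have "jacobi_map m (?g q - ?g' q') = jacobi_map m q - phase u (jacobi_map m q')"
    by (simp add: jacobi_map_diff jacobi_map_rigid_motion \<theta>)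
  ultimately have "mass_norm m (?g q - ?g' q') = quotient_dist (shape_map m q) (shape_map m q')"
    using quotient_dist_nonneg[of "shape_map m q" "shape_map m q'"]
        by (simp add: mass_norm_jacobi u)
  moreover have "(?g, ?g') \<in> rigid_motions \<times> rigid_motions"
    by (auto simp: rigid_motions_def)
  ultimately show "quotient_dist (shape_map m q) (shape_map m q')
      \<in> (\<lambda>(g, g'). mass_norm m (g q - g' q')) ` (rigid_motions \<times> rigid_motions)"
    by (metis (mono_tags, lifting) case_prod_conv image_eqI)
next
  fix x assume "x \<in> (\<lambda>(g, g'). mass_norm m (g q - g' q')) ` (rigid_motions \<times> rigid_motions)"
  then obtain \<theta> c \<theta>' c' where x: "x = mass_norm m (rigid_motion \<theta> c q - rigid_motion \<theta>' c' q')"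
    by (auto simp: rigid_motions_def)
  have "quotient_dist (shape_map m q) (shape_map m q')
      \<le> norm (phase (cis \<theta>) (jacobi_map m q) - phase (cis \<theta>') (jacobi_map m q'))"
    using quotient_dist_le_norm[of "phase (cis \<theta>) (jacobi_map m q)"
        "phase (cis \<theta>') (jacobi_map m q')"]
    by (simp add: rot_map_phase shape_map_eq)
  also have "\<dots> \<le> x"
    unfolding x mass_norm_jacobi jacobi_map_diff jacobi_map_rigid_motion
    using m_pos by (intro real_le_rsqrt) simp
  finally show "quotient_dist (shape_map m q) (shape_map m q') \<le> x" .
qed

lemma jacobi_map_surj: "\<exists>q. jacobi_map m q = Z \<and> moment m q = 0"
proof -
  obtain z1 z2 where Z: "Z = (z1, z2)" by fastforce
  define m1 m2 m3 :: complex where mm: "m1 = of_real (m $ 1)" "m2 = of_real (m $ 2)"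
      "m3 = of_real (m $ 3)"
  have nz: "m1 + m2 \<noteq> 0" "m1 + m2 + m3 \<noteq> 0"
    unfolding mm using m_pos by (metis add_pos_pos less_irrefl of_real_add of_real_eq_0_iff)+
  define a b where "a = z1 / of_real (mu1 m)" and "b = z2 / of_real (mu2 m)"
  define c where "c = - m3 * b / (m1 + m2 + m3)"
  define q :: triangle where
    "q = vector [c + m2 * a / (m1 + m2), c - m1 * a / (m1 + m2), c + b]"
  have q: "q $ 1 = c + m2 * a / (m1 + m2)" "q $ 2 = c - m1 * a / (m1 + m2)" "q $ 3 = c + b"
    by (simp_all add: q_def)
  have d: "q $ 1 - q $ 2 = a"
  proof -
    have "q $ 1 - q $ 2 = (m1 + m2) * a / (m1 + m2)"
      by (simp add: q add_divide_distrib distrib_right)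
    then show ?thesis using nz by simp
  qed
  have e: "m1 * q $ 1 + m2 * q $ 2 = (m1 + m2) * c"
    using nz by (simp add: q divide_simps) (simp add: algebra_simps)
  have "jacobi_map m q = Z"
    using mu_pos nz unfolding jacobi_map_def d of_real_add mm[symmetric] e
    by (simp add: Z q a_def b_def)
  moreover have "moment m q = (m1 + m2) * c + m3 * (c + b)"
    unfolding e[symmetric] by (simp add: moment_def sum_3 mm q)
  then have "moment m q = (m1 + m2 + m3) * c + m3 * b"
    by (simp add: algebra_simps)
  then have "moment m q = 0"
    using nz by (simp add: c_def)
  ultimately show ?thesis by blast
qed

lemma jacobi_map_eq_0:
  assumes "jacobi_map m v = 0" "moment m v = 0" shows "v = 0"
proof -
  have "mass_inner m v v = 0" using assms by (simp add: mass_inner_jacobi herm_self)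
  moreover have "mass_inner m v v = of_real (m $ 1 * (cmod (v $ 1))\<^sup>2 + m $ 2 * (cmod (v $ 2))\<^sup>2 + m
      $ 3 * (cmod (v $ 3))\<^sup>2)"
    unfolding of_real_add of_real_mult complex_norm_square
    by (simp add: mass_inner_def sum_3 mult_ac)
  ultimately have "m $ 1 * (cmod (v $ 1))\<^sup>2 + m $ 2 * (cmod (v $ 2))\<^sup>2 + m $ 3 * (cmod (v $ 3))\<^sup>2
      = 0"
    by (metis of_real_eq_0_iff)
  moreover have "m $ i * (cmod (v $ i))\<^sup>2 \<ge> 0" for i
    using m_pos exhaust_3[of i] by auto
  ultimately have "m $ i * (cmod (v $ i))\<^sup>2 = 0" for i
    using exhaust_3[of i] by (smt (verit))
  moreover have "m $ i \<noteq> 0" for i using m_pos exhaust_3[of i] by auto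
  ultimately show ?thesis by (simp add: vec_eq_iff)
qed

lemma bounded_linear_Re_mass_inner: "bounded_linear (\<lambda>w. Re (mass_inner m v w))"
  by (rule linear_conv_bounded_linear[THEN iffD1], rule linearI)
    (simp_all add: mass_inner_def sum_3 scaleR_conv_of_real[where 'a=complex] algebra_simps)

text \<open>
  Translations and rotations about the origin already give tangent vectors that force both
  conditions.
\<close>

lemma horizontal_imp:
  assumes "horizontal m q v"
  shows "moment m v = 0" "Im (herm (jacobi_map m q) (jacobi_map m v)) = 0"
proof -
  have tangent: "Re (mass_inner m v u) = 0" if "u \<in> orbit_tangent_space q" for u
    using assms that by (simp add: horizontal_def)
  let ?d = "\<chi> i. moment m v"
  have "((\<lambda>t::real. q + t *\<^sub>R ?d) has_vector_derivative ?d) (at 0)"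
    by (auto intro!: derivative_eq_intros)
  moreover have "q + t *\<^sub>R ?d = rigid_motion 0 (of_real t * moment m v) q" for t :: real
    by (simp add: rigid_motion_def vec_eq_iff scaleR_conv_of_real[where 'a=complex])
  then have "\<forall>t::real. q + t *\<^sub>R ?d \<in> shape_class q"
    unfolding shape_class_def rigid_motions_def by blast
  ultimately have "?d \<in> orbit_tangent_space q"
    unfolding orbit_tangent_space_def by (intro CollectI exI[of _ "\<lambda>t::real. q + t *\<^sub>R ?d"]) simp
  then have "Re (mass_inner m v ?d) = 0" by (rule tangent)
  moreover have "mass_inner m v ?d = of_real ((cmod (moment m v))\<^sup>2)"
    unfolding complex_norm_square
    by (simp add: mass_inner_def moment_def sum_3 algebra_simps)
  ultimately show 0: "moment m v = 0" by simp
  let ?e = "\<chi> i. \<i> * q $ i"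
  have "((\<lambda>t. cos t *\<^sub>R q + sin t *\<^sub>R ?e) has_vector_derivative ?e) (at 0)"
    by (auto intro!: derivative_eq_intros)
  moreover have "cos t *\<^sub>R q + sin t *\<^sub>R ?e = rigid_motion t 0 q" for t :: real
    by (simp add: rigid_motion_def vec_eq_iff complex_eq_iff)
  then have "\<forall>t. cos t *\<^sub>R q + sin t *\<^sub>R ?e \<in> shape_class q"
    unfolding shape_class_def rigid_motions_def by blast
  ultimately have "?e \<in> orbit_tangent_space q"
    unfolding orbit_tangent_space_def by (intro CollectI exI[of _ "\<lambda>t. cos t *\<^sub>R q + sin t *\<^sub>R ?e"])
        simp
  then have "Re (mass_inner m v ?e) = 0" by (rule tangent)
  moreover have "mass_inner m v ?e = \<i> * mass_inner m v q"
    by (simp add: mass_inner_def sum_3 algebra_simps)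
  ultimately show "Im (herm (jacobi_map m q) (jacobi_map m v)) = 0"
    by (simp add: mass_inner_jacobi 0)
qed

text \<open>
  A curve in the orbit need not have a differentiable angle or translation part. However, along
  it the product with \<open>v\<close> is the real number \<open>k = \<langle>q, v\<rangle>\<close> rotated by some angle, so that \<open>k\<close>
  times its real part is maximal at the initial time and has derivative zero there. If \<open>k = 0\<close>,
  the product vanishes along the whole curve.
\<close>

lemma horizontalI:
  assumes "moment m v = 0" "Im (herm (jacobi_map m q) (jacobi_map m v)) = 0"
  shows "horizontal m q v"
  unfolding horizontal_def
proof
  fix u assume "u \<in> orbit_tangent_space q"
  then obtain c where c: "c 0 = q" "\<And>t::real. c t \<in> shape_class q"
      "(c has_vector_derivative u) (at 0)"
    unfolding orbit_tangent_space_def by blast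
  define k where "k = Re (herm (jacobi_map m q) (jacobi_map m v))"
  have k: "herm (jacobi_map m q) (jacobi_map m v) = of_real k"
    using assms by (simp add: k_def complex_eq_iff)
  define f where "f = (\<lambda>t. k * Re (mass_inner m v (c t)))"
  have "((\<lambda>t. Re (mass_inner m v (c t))) has_vector_derivative Re (mass_inner m v u)) (at 0)"
    by (rule bounded_linear.has_vector_derivative[OF bounded_linear_Re_mass_inner c(3)])
  then have deriv: "(f has_real_derivative k * Re (mass_inner m v u)) (at 0)"
    and deriv': "((\<lambda>t. Re (mass_inner m v (c t))) has_real_derivative Re (mass_inner m v u)) (at 0)"
    unfolding f_def by (simp_all add: has_real_derivative_iff_has_vector_derivative[symmetric]
        DERIV_cmult)
  have ct: "\<exists>\<theta>. mass_inner m v (c t) = cis \<theta> * of_real k" for t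
  proof -
    obtain \<theta> d where "c t = rigid_motion \<theta> d q"
      using c(2)[of t] unfolding shape_class_def rigid_motions_def by blast
    then have "mass_inner m v (c t) = cis \<theta> * of_real k"
      by (simp add: mass_inner_jacobi assms jacobi_map_rigid_motion herm_phase_left k)
    then show ?thesis ..
  qed
  show "Re (mass_inner m v u) = 0"
  proof (cases "k = 0")
    case True
    then have "mass_inner m v (c t) = 0" for t using ct[of t] by auto
    with deriv' show ?thesis by (metis DERIV_const DERIV_unique ext zero_complex.simps(1))
  next
    case False
    have "f t \<le> f 0" for t
    proof -
      obtain \<theta> where "mass_inner m v (c t) = cis \<theta> * of_real k" using ct by blast
      then have "f t = k\<^sup>2 * cos \<theta>" by (simp add: f_def power2_eq_square)
      also have "\<dots> \<le> k\<^sup>2 * 1" by (intro mult_left_mono) auto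
      also have "\<dots> = f 0" by (simp add: f_def c mass_inner_jacobi assms k power2_eq_square)
      finally show ?thesis .
    qed
    then have "k * Re (mass_inner m v u) = 0"
      by (intro DERIV_local_max[OF deriv zero_less_one]) auto
    with False show ?thesis by simp
  qed
qed

lemma horizontal_lineD:
  assumes "horizontal_line m q v"
  shows "jacobi_map m v \<noteq> 0" "Im (herm (jacobi_map m q) (jacobi_map m v)) = 0"
proof -
  have "horizontal m q v" using assms by (metis horizontal_line_def add.right_neutral
      scale_zero_left)
  from horizontal_imp[OF this] show "Im (herm (jacobi_map m q) (jacobi_map m v)) = 0"
    "jacobi_map m v \<noteq> 0"
    using assms jacobi_map_eq_0 by (auto simp: horizontal_line_def)
qed

lemma ex_horizontal_line:
  assumes "V \<noteq> 0" "Im (herm Z V) = 0"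
  shows "\<exists>q v. horizontal_line m q v \<and> jacobi_map m q = Z \<and> jacobi_map m v = V"
proof -
  obtain q v where qv: "jacobi_map m q = Z" "jacobi_map m v = V" "moment m v = 0"
    using jacobi_map_surj by metis
  have "jacobi_map m 0 = 0" using jacobi_map_diff[of m 0 0] by simp
  then have "v \<noteq> 0" using qv assms(1) by auto
  moreover have "horizontal m (q + t *\<^sub>R v) v" for t
    using assms(2) by (intro horizontalI)
      (simp_all add: qv jacobi_map_line herm_add_left herm_scale_left herm_self)
  ultimately show ?thesis using qv unfolding horizontal_line_def by blast
qed

end

section \<open>The orbit distance bounds the length of paths\<close>

definition speed :: "(real \<Rightarrow> real ^ 3) \<Rightarrow> real \<Rightarrow> real" where
  "speed \<gamma> t = sqrt (shape_metric (\<gamma> t) (vector_derivative \<gamma> (at t)))"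

lemma speed_nonneg: "speed \<gamma> t \<ge> 0"
  by (simp add: speed_def shape_metric_def)

lemma speed_eq:
  assumes "(\<gamma> has_vector_derivative d) (at t)"
  shows "speed \<gamma> t = norm d / sqrt (2 * norm (\<gamma> t))"
  using vector_derivative_at[OF assms] by (simp add: speed_def shape_metric_def real_sqrt_divide)

lemma shape_length_eq:
  "shape_length \<gamma> a b = (\<integral>\<^sup>+t. ennreal (speed \<gamma> t) * indicator {a..b} t \<partial>lborel)"
  by (simp add: shape_length_def speed_def)

text \<open>
  The factor is continuous away from the origin and equals \<open>1 / sqrt (2 \<bar>w\<bar>)\<close> on the diagonal,
  which is the conformal factor of the shape metric.
\<close>

lemma quotient_dist_eq_norm_times:
  "quotient_dist w w' = norm (w - w') *
     sqrt (2 / (norm w + norm w' + sqrt ((norm w + norm w')\<^sup>2 - (norm (w - w'))\<^sup>2)))"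
proof -
  define S x s where "S = norm w + norm w'" and "x = norm (w - w')" and "s = sqrt (S\<^sup>2 - x\<^sup>2)"
  have x: "0 \<le> x" "x \<le> S" by (simp_all add: x_def S_def norm_triangle_ineq4)
  then have "x\<^sup>2 \<le> S\<^sup>2" by (intro power_mono)
  then have s: "s\<^sup>2 = S\<^sup>2 - x\<^sup>2" "s \<ge> 0" by (simp_all add: s_def)
  have "2 * (S - s) = x\<^sup>2 * (2 / (S + s))"
  proof (cases "S + s = 0")
    case True then show ?thesis using x s by auto
  next
    case False then show ?thesis using s by (simp add: field_simps power2_eq_square)
  qed
  then have "sqrt (2 * (S - s)) = sqrt (x\<^sup>2) * sqrt (2 / (S + s))"
    by (simp only: real_sqrt_mult)
  then show ?thesis
    using x(1) unfolding quotient_dist_def S_def[symmetric] x_def[symmetric] s_def[symmetric]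
    by simp
qed

lemma quotient_dist_le_near:
  assumes d: "(\<gamma> has_vector_derivative d) (at \<tau>)" and nz: "\<gamma> \<tau> \<noteq> 0" and "\<eta> > 0"
  shows "\<exists>\<delta>>0. \<forall>x y. x \<le> \<tau> \<and> \<tau> \<le> y \<and> y - x < \<delta> \<longrightarrow>
           quotient_dist (\<gamma> x) (\<gamma> y) \<le> (speed \<gamma> \<tau> + \<eta>) * (y - x)"
proof -
  \<comment> \<open>A margin \<open>e\<close> for both factors, the difference quotient and the conformal factor.\<close>
  define \<kappa> where "\<kappa> = 1 / sqrt (2 * norm (\<gamma> \<tau>))"
  have "((\<lambda>e. (norm d + e) * (\<kappa> + e)) \<longlongrightarrow> (norm d + 0) * (\<kappa> + 0)) (at_right 0)"
    by (intro tendsto_intros)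
  moreover have "(norm d + 0) * (\<kappa> + 0) < speed \<gamma> \<tau> + \<eta>"
    using \<open>\<eta> > 0\<close> by (simp add: \<kappa>_def speed_eq[OF d])
  ultimately have "\<forall>\<^sub>F e in at_right 0. (norm d + e) * (\<kappa> + e) < speed \<gamma> \<tau> + \<eta>"
    by (rule order_tendstoD)
  then have "\<forall>\<^sub>F e in at_right 0. (norm d + e) * (\<kappa> + e) < speed \<gamma> \<tau> + \<eta> \<and> e > 0"
    by (intro eventually_conj eventually_at_right_less)
  then obtain e where e: "e > 0" "(norm d + e) * (\<kappa> + e) < speed \<gamma> \<tau> + \<eta>"
    by (metis (mono_tags, lifting) eventually_happens trivial_limit_at_right_real)
  obtain \<delta>1 where \<delta>1: "\<delta>1 > 0"
    "\<And>t. \<bar>t - \<tau>\<bar> < \<delta>1 \<Longrightarrow> norm (\<gamma> t - \<gamma> \<tau> - (t - \<tau>) *\<^sub>R d) \<le> e * \<bar>t - \<tau>\<bar>"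
    using d \<open>e > 0\<close> unfolding has_vector_derivative_def has_derivative_at_alt
        by (metis real_norm_def)
  define K where "K = (\<lambda>w w' :: real ^ 3.
    sqrt (2 / (norm w + norm w' + sqrt ((norm w + norm w')\<^sup>2 - (norm (w - w'))\<^sup>2))))"
  have cont: "\<gamma> \<midarrow>\<tau>\<rightarrow> \<gamma> \<tau>"
    using has_vector_derivative_continuous[OF d] by (simp add: continuous_at)
  have cont': "((\<lambda>p. \<gamma> (fst p)) \<longlongrightarrow> \<gamma> \<tau>) (nhds (\<tau>, \<tau>))" "((\<lambda>p. \<gamma> (snd p)) \<longlongrightarrow> \<gamma> \<tau>) (nhds (\<tau>, \<tau>))"
    using cont
    by (auto intro!: filterlim_compose[of \<gamma> _ "nhds \<tau>"] simp: tendsto_at_iff_tendsto_nhds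
        intro: tendsto_eq_intros filterlim_ident)
  have "((\<lambda>p. K (\<gamma> (fst p)) (\<gamma> (snd p))) \<longlongrightarrow> K (\<gamma> \<tau>) (\<gamma> \<tau>)) (nhds (\<tau>, \<tau>))"
    unfolding K_def using nz by (intro tendsto_intros cont') (auto simp: real_sqrt_mult)
  moreover have "K (\<gamma> \<tau>) (\<gamma> \<tau>) = \<kappa>"
  proof -
    have "norm (\<gamma> \<tau>) + norm (\<gamma> \<tau>) + sqrt ((norm (\<gamma> \<tau>) + norm (\<gamma> \<tau>))\<^sup>2 - (norm (\<gamma> \<tau> - \<gamma> \<tau>))\<^sup>2)
        = 4 * norm (\<gamma> \<tau>)"
      by (simp add: real_sqrt_mult)
    then show ?thesis unfolding K_def by (simp add: \<kappa>_def real_sqrt_divide real_sqrt_mult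
        field_simps)
  qed
  ultimately have "\<forall>\<^sub>F p in nhds (\<tau>, \<tau>). K (\<gamma> (fst p)) (\<gamma> (snd p)) < \<kappa> + e"
    using e(1) by (intro order_tendstoD(2)) auto
  then obtain \<delta>2 where \<delta>2: "\<delta>2 > 0" "\<And>p. dist p (\<tau>, \<tau>) < \<delta>2 \<Longrightarrow> K (\<gamma> (fst p)) (\<gamma> (snd p)) < \<kappa> + e"
    unfolding eventually_nhds_metric by blast
  show ?thesis
  proof (intro exI[of _ "min \<delta>1 (\<delta>2 / 2)"] conjI allI impI)
    fix x y assume xy: "x \<le> \<tau> \<and> \<tau> \<le> y \<and> y - x < min \<delta>1 (\<delta>2 / 2)"
    have "\<gamma> x - \<gamma> y = (\<gamma> x - \<gamma> \<tau> - (x - \<tau>) *\<^sub>R d) - (\<gamma> y - \<gamma> \<tau> - (y - \<tau>) *\<^sub>R d) - (y - x) *\<^sub>R d"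
      by (simp add: algebra_simps)
    also have "norm \<dots> \<le> norm (\<gamma> x - \<gamma> \<tau> - (x - \<tau>) *\<^sub>R d) + norm (\<gamma> y - \<gamma> \<tau> - (y - \<tau>) *\<^sub>R d) + norm
        ((y - x) *\<^sub>R d)"
      by (meson norm_triangle_ineq4 order_trans add_right_mono)
    also have "\<dots> \<le> e * \<bar>x - \<tau>\<bar> + e * \<bar>y - \<tau>\<bar> + (y - x) * norm d"
      using \<delta>1(2)[of x] \<delta>1(2)[of y] xy by (intro add_mono) auto
    also have "\<dots> = (norm d + e) * (y - x)"
    proof -
      have "\<bar>x - \<tau>\<bar> = \<tau> - x" "\<bar>y - \<tau>\<bar> = y - \<tau>" using xy by auto
      then show ?thesis by (simp add: algebra_simps)
    qed
    finally have 1: "norm (\<gamma> x - \<gamma> y) \<le> (norm d + e) * (y - x)" .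
    have "dist (x, y) (\<tau>, \<tau>) \<le> \<bar>x - \<tau>\<bar> + \<bar>y - \<tau>\<bar>"
      by (simp add: dist_Pair_Pair dist_real_def sqrt_sum_squares_le_sum_abs)
    also have "\<dots> < \<delta>2" using xy by auto
    finally have 2: "K (\<gamma> x) (\<gamma> y) < \<kappa> + e" using \<delta>2(2)[of "(x, y)"] by simp
    have "quotient_dist (\<gamma> x) (\<gamma> y) = norm (\<gamma> x - \<gamma> y) * K (\<gamma> x) (\<gamma> y)"
      unfolding K_def by (rule quotient_dist_eq_norm_times)
    also have "\<dots> \<le> ((norm d + e) * (y - x)) * (\<kappa> + e)"
    proof (rule mult_mono[OF 1 less_imp_le[OF 2]])
      show "0 \<le> K (\<gamma> x) (\<gamma> y)"
      proof -
        have "(norm (\<gamma> x - \<gamma> y))\<^sup>2 \<le> (norm (\<gamma> x) + norm (\<gamma> y))\<^sup>2"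
          by (intro power_mono norm_triangle_ineq4) simp
        then show ?thesis unfolding K_def by simp
      qed
      show "0 \<le> (norm d + e) * (y - x)" using xy e by simp
    qed
    also have "\<dots> = ((norm d + e) * (\<kappa> + e)) * (y - x)" by simp
    also have "\<dots> \<le> (speed \<gamma> \<tau> + \<eta>) * (y - x)"
      using e xy by (intro mult_right_mono) auto
    finally show "quotient_dist (\<gamma> x) (\<gamma> y) \<le> (speed \<gamma> \<tau> + \<eta>) * (y - x)" .
  qed (use \<delta>1 \<delta>2 in auto)
qed

lemma continuous_on_quotient_dist:
  assumes "continuous_on S f" "continuous_on S g"
  shows "continuous_on S (\<lambda>x. quotient_dist (f x) (g x))"
  unfolding quotient_dist_def by (intro continuous_intros assms)

text \<open>
  The estimate with an error \<open>\<eta> (y - x)\<close> is additive over adjacent intervals, so by bisection it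
  is enough to have it around every point, where it holds because the speed is continuous. At
  the end points nothing but continuity of the path is known; they are reached as limits.
\<close>

lemma quotient_dist_le_integral_smooth:
  assumes ab: "a \<le> b" and cont: "continuous_on {a..b} \<gamma>"
    and deriv: "\<And>t. t \<in> {a<..<b} \<Longrightarrow> (\<gamma> has_vector_derivative D t) (at t)"
    and contD: "continuous_on {a<..<b} D"
    and nz: "\<And>t. t \<in> {a<..<b} \<Longrightarrow> \<gamma> t \<noteq> 0"
    and int: "speed \<gamma> integrable_on {a..b}"
  shows "quotient_dist (\<gamma> a) (\<gamma> b) \<le> integral {a..b} (speed \<gamma>)"
proof -
  have intsub: "speed \<gamma> integrable_on {x..y}" if "a \<le> x" "y \<le> b" for x y
    using int that by (meson atLeastatMost_subset_iff integrable_on_subinterval)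
  have cont_speed: "continuous_on {a<..<b} (speed \<gamma>)"
  proof -
    have "continuous_on {a<..<b} (\<lambda>t. norm (D t) / sqrt (2 * norm (\<gamma> t)))"
      using nz by (intro continuous_intros contD continuous_on_subset[OF cont]) auto
    then show ?thesis
      by (rule continuous_on_cong[THEN iffD1, rotated -1]) (simp_all add: speed_eq[OF deriv])
  qed
  have eps: "quotient_dist (\<gamma> x) (\<gamma> y) \<le> integral {x..y} (speed \<gamma>) + \<eta> * (y - x)"
    if xy: "a < x" "x \<le> y" "y < b" and "\<eta> > 0" for x y \<eta>
  proof -
    define P where "P = (\<lambda>u v. x \<le> u \<and> v \<le> y \<longrightarrow>
      quotient_dist (\<gamma> u) (\<gamma> v) \<le> integral {u..v} (speed \<gamma>) + \<eta> * (v - u))"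
    have "P x y"
    proof (rule Bolzano[OF xy(2)])
      fix u v w assume uvw: "P u v" "P v w" "u \<le> v" "v \<le> w"
      show "P u w"
        unfolding P_def
      proof
        assume uw: "x \<le> u \<and> w \<le> y"
        then have "quotient_dist (\<gamma> u) (\<gamma> v) \<le> integral {u..v} (speed \<gamma>) + \<eta> * (v - u)"
          "quotient_dist (\<gamma> v) (\<gamma> w) \<le> integral {v..w} (speed \<gamma>) + \<eta> * (w - v)"
          using uvw by (simp_all add: P_def)
        moreover have "integral {u..v} (speed \<gamma>) + integral {v..w} (speed \<gamma>)
            = integral {u..w} (speed \<gamma>)"
          using uvw uw xy by (intro Henstock_Kurzweil_Integration.integral_combine intsub) auto
        ultimately show "quotient_dist (\<gamma> u) (\<gamma> w) \<le> integral {u..w} (speed \<gamma>) + \<eta> * (w - u)"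
          using quotient_dist_triangle[of "\<gamma> u" "\<gamma> w" "\<gamma> v"] by (simp add: algebra_simps)
      qed
    next
      fix \<tau> assume \<tau>: "x \<le> \<tau>" "\<tau> \<le> y"
      then have \<tau>': "\<tau> \<in> {a<..<b}" using xy by auto
      obtain \<delta>1 where \<delta>1: "\<delta>1 > 0" "\<And>u v. u \<le> \<tau> \<and> \<tau> \<le> v \<and> v - u < \<delta>1 \<Longrightarrow>
           quotient_dist (\<gamma> u) (\<gamma> v) \<le> (speed \<gamma> \<tau> + \<eta> / 2) * (v - u)"
        using quotient_dist_le_near[OF deriv[OF \<tau>'] nz[OF \<tau>'], of "\<eta> / 2"] \<open>\<eta> > 0\<close> by auto
      obtain \<delta>2 where \<delta>2: "\<delta>2 > 0" "\<And>t. t \<in> {a<..<b} \<Longrightarrow> dist t \<tau> < \<delta>2 \<Longrightarrow> dist (speed \<gamma> t) (speed \<gamma> \<tau>)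
          < \<eta> / 2"
        using cont_speed \<tau>' \<open>\<eta> > 0\<close> unfolding continuous_on_iff by (metis half_gt_zero)
      have "P u v" if uv: "u \<le> \<tau> \<and> \<tau> \<le> v \<and> v - u < min \<delta>1 \<delta>2" for u v
        unfolding P_def
      proof
        assume xu: "x \<le> u \<and> v \<le> y"
        have "(speed \<gamma> \<tau> - \<eta> / 2) * (v - u) = integral {u..v} (\<lambda>_. speed \<gamma> \<tau> - \<eta> / 2)"
          using uv by simp
        also have "\<dots> \<le> integral {u..v} (speed \<gamma>)"
        proof (rule integral_le)
          fix t assume t: "t \<in> {u..v}"
          then have "dist (speed \<gamma> t) (speed \<gamma> \<tau>) < \<eta> / 2"
            using uv xu xy by (intro \<delta>2) (auto simp: dist_real_def)
          then show "speed \<gamma> \<tau> - \<eta> / 2 \<le> speed \<gamma> t" 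
            unfolding dist_real_def abs_less_iff by linarith
        qed (use xu xy in \<open>auto intro: intsub\<close>)
        finally have lower: "(speed \<gamma> \<tau> - \<eta> / 2) * (v - u) \<le> integral {u..v} (speed \<gamma>)" .
        show "quotient_dist (\<gamma> u) (\<gamma> v) \<le> integral {u..v} (speed \<gamma>) + \<eta> * (v - u)"
        proof -
          have "\<eta> * (v - u) = (\<eta> / 2) * (v - u) + (\<eta> / 2) * (v - u)" by simp
          then show ?thesis
            using lower \<delta>1(2)[of u v] uv
            unfolding left_diff_distrib distrib_right by linarith
        qed
      qed
      then show "\<exists>d>0. \<forall>u v. u \<le> \<tau> \<and> \<tau> \<le> v \<and> v - u < d \<longrightarrow> P u v"
        using \<delta>1(1) \<delta>2(1) by (intro exI[of _ "min \<delta>1 \<delta>2"]) auto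
    qed
    then show ?thesis by (simp add: P_def)
  qed
  have inner: "quotient_dist (\<gamma> x) (\<gamma> y) \<le> integral {x..y} (speed \<gamma>)"
      if xy: "a < x" "x \<le> y" "y < b" for x y
  proof (rule field_le_epsilon)
    fix e :: real assume "e > 0"
    have "e / (y - x + 1) * (y - x) \<le> e"
      using \<open>e > 0\<close> xy by (simp add: divide_simps algebra_simps)
    then show "quotient_dist (\<gamma> x) (\<gamma> y) \<le> integral {x..y} (speed \<gamma>) + e"
      using eps[OF xy, of "e / (y - x + 1)"] \<open>e > 0\<close> xy by (simp add: add_pos_nonneg)
  qed
  show ?thesis
  proof (cases "a = b")
    case True then show ?thesis by (simp add: quotient_dist_eq_0_iff[THEN iffD2])
  next
    case False
    define r where "r = (b - a) / 2"
    have r: "r > 0" "a + r = b - r" using False ab by (simp_all add: r_def field_simps)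
    have "quotient_dist (\<gamma> (a + 0)) (\<gamma> (b - 0)) \<le> integral {a..b} (speed \<gamma>)"
    proof (rule continuous_le_on_closure[where S = "{0<..<r}"
        and f = "\<lambda>s. quotient_dist (\<gamma> (a + s)) (\<gamma> (b - s))"])
      show "continuous_on (closure {0<..<r}) (\<lambda>s. quotient_dist (\<gamma> (a + s)) (\<gamma> (b - s)))"
        using r by (intro continuous_on_quotient_dist continuous_on_compose2[OF cont])
          (auto intro!: continuous_intros)
      show "0 \<in> closure {0<..<r}" using r by simp
      fix s assume s: "s \<in> {0<..<r}"
      then have "quotient_dist (\<gamma> (a + s)) (\<gamma> (b - s)) \<le> integral {a + s..b - s} (speed \<gamma>)"
        using r by (intro inner) auto
      also have "\<dots> \<le> integral {a..b} (speed \<gamma>)"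
        using s by (intro integral_subset_le intsub) (auto simp: speed_nonneg)
      finally show "quotient_dist (\<gamma> (a + s)) (\<gamma> (b - s)) \<le> integral {a..b} (speed \<gamma>)" .
    qed
    then show ?thesis by simp
  qed
qed

text \<open>
  Every parameter has a neighbourhood in which it is the only possible breakpoint; split there
  and use bisection again.
\<close>

lemma quotient_dist_le_integral_nonzero:
  assumes ab: "a \<le> b" and cont: "continuous_on {a..b} \<gamma>" and S: "finite S"
    and deriv: "\<And>t. t \<in> {a..b} - S \<Longrightarrow> (\<gamma> has_vector_derivative D t) (at t)"
    and contD: "continuous_on ({a..b} - S) D"
    and nz: "\<And>t. t \<in> {a<..<b} \<Longrightarrow> \<gamma> t \<noteq> 0"
    and int: "speed \<gamma> integrable_on {a..b}"
  shows "quotient_dist (\<gamma> a) (\<gamma> b) \<le> integral {a..b} (speed \<gamma>)"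
proof -
  have intsub: "speed \<gamma> integrable_on {x..y}" if "a \<le> x" "y \<le> b" for x y
    using int that by (meson atLeastatMost_subset_iff integrable_on_subinterval)
  define P where "P = (\<lambda>u v. a \<le> u \<and> v \<le> b \<longrightarrow>
      quotient_dist (\<gamma> u) (\<gamma> v) \<le> integral {u..v} (speed \<gamma>))"
  have trans: "P u w" if uvw: "P u v" "P v w" "u \<le> v" "v \<le> w" for u v w
    unfolding P_def
  proof
    assume uw: "a \<le> u \<and> w \<le> b"
    then have "quotient_dist (\<gamma> u) (\<gamma> v) \<le> integral {u..v} (speed \<gamma>)"
      "quotient_dist (\<gamma> v) (\<gamma> w) \<le> integral {v..w} (speed \<gamma>)"
      using uvw by (simp_all add: P_def)
    moreover have "integral {u..v} (speed \<gamma>) + integral {v..w} (speed \<gamma>)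
        = integral {u..w} (speed \<gamma>)"
      using uvw uw by (intro Henstock_Kurzweil_Integration.integral_combine intsub) auto
    ultimately show "quotient_dist (\<gamma> u) (\<gamma> w) \<le> integral {u..w} (speed \<gamma>)"
      using quotient_dist_triangle[of "\<gamma> u" "\<gamma> w" "\<gamma> v"] by simp
  qed
  have smooth: "P u v" if uv: "u \<le> v" and avoid: "{u<..<v} \<inter> S = {}" for u v
    unfolding P_def
  proof
    assume sub: "a \<le> u \<and> v \<le> b"
    then have sub': "{u<..<v} \<subseteq> {a..b} - S" using avoid by auto
    show "quotient_dist (\<gamma> u) (\<gamma> v) \<le> integral {u..v} (speed \<gamma>)"
    proof (rule quotient_dist_le_integral_smooth[OF uv, where D = D])
      show "continuous_on {u..v} \<gamma>" by (rule continuous_on_subset[OF cont]) (use sub in auto)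
      show "continuous_on {u<..<v} D" by (rule continuous_on_subset[OF contD sub'])
    qed (use sub sub' deriv nz in \<open>auto intro: intsub\<close>)
  qed
  have "P a b"
  proof (rule Bolzano[OF ab])
    fix \<tau>
    obtain d where d: "d > 0" "\<forall>x\<in>S. x \<noteq> \<tau> \<longrightarrow> d \<le> dist \<tau> x"
      using finite_set_avoid[OF S] by blast
    have "P u v" if uv: "u \<le> \<tau> \<and> \<tau> \<le> v \<and> v - u < d" for u v
      using uv d(2) by (intro trans[of u \<tau> v] smooth) (fastforce simp: dist_real_def)+
    then show "\<exists>d>0. \<forall>u v. u \<le> \<tau> \<and> \<tau> \<le> v \<and> v - u < d \<longrightarrow> P u v"
      using d(1) by blast
  qed (rule trans)
  then show ?thesis by (simp add: P_def)
qed

text \<open>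
  A path through the origin is only considered before its first and after its last visit there,
  because what happens in between can only add to the length.
\<close>

lemma quotient_dist_le_integral_speed:
  assumes ab: "a \<le> b" and pw: "\<gamma> piecewise_C1_differentiable_on {a..b}"
    and int: "speed \<gamma> integrable_on {a..b}"
  shows "quotient_dist (\<gamma> a) (\<gamma> b) \<le> integral {a..b} (speed \<gamma>)"
proof -
  from pw obtain S D where cont: "continuous_on {a..b} \<gamma>" and S: "finite S"
    and deriv: "\<And>t. t \<in> {a..b} - S \<Longrightarrow> (\<gamma> has_vector_derivative D t) (at t)"
    and contD: "continuous_on ({a..b} - S) D"
    unfolding piecewise_C1_differentiable_on_def C1_differentiable_on_def by blast
  have intsub: "speed \<gamma> integrable_on {x..y}" if "a \<le> x" "y \<le> b" for x y
    using int that by (meson atLeastatMost_subset_iff integrable_on_subinterval)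
  have sub: "quotient_dist (\<gamma> u) (\<gamma> v) \<le> integral {u..v} (speed \<gamma>)"
    if "a \<le> u" "u \<le> v" "v \<le> b" "\<And>t. t \<in> {u<..<v} \<Longrightarrow> \<gamma> t \<noteq> 0" for u v
  proof (rule quotient_dist_le_integral_nonzero[OF that(2) _ S, where D = D])
    show "continuous_on {u..v} \<gamma>" by (rule continuous_on_subset[OF cont]) (use that in auto)
    show "continuous_on ({u..v} - S) D" by (rule continuous_on_subset[OF contD]) (use that in auto)
  qed (use that deriv in \<open>auto intro: intsub\<close>)
  define Z where "Z = {t \<in> {a..b}. \<gamma> t = 0}"
  have "Z = {a..b} \<inter> \<gamma> -` {0}" by (auto simp: Z_def)
  then have "closed Z" using continuous_closed_preimage[OF cont] by auto
  moreover have "bounded Z" by (rule bounded_subset[of "{a..b}"]) (auto simp: Z_def)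
  ultimately have "compact Z" by (simp add: compact_eq_bounded_closed)
  show ?thesis
  proof (cases "Z = {}")
    case True then show ?thesis using ab by (intro sub) (auto simp: Z_def)
  next
    case False
    obtain \<tau>1 where \<tau>1: "\<tau>1 \<in> Z" "\<And>t. t \<in> Z \<Longrightarrow> \<tau>1 \<le> t"
      using compact_attains_inf[OF \<open>compact Z\<close> False] by blast
    obtain \<tau>2 where \<tau>2: "\<tau>2 \<in> Z" "\<And>t. t \<in> Z \<Longrightarrow> t \<le> \<tau>2"
      using compact_attains_sup[OF \<open>compact Z\<close> False] by blast
    have le: "a \<le> \<tau>1" "\<tau>1 \<le> \<tau>2" "\<tau>2 \<le> b" using \<tau>1 \<tau>2 by (auto simp: Z_def)
    have "\<gamma> t \<noteq> 0" if "t \<in> {a<..<\<tau>1} \<union> {\<tau>2<..<b}" for t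
    proof
      assume "\<gamma> t = 0"
      then have "t \<in> Z" using that le by (auto simp: Z_def)
      then show False using that \<tau>1(2) \<tau>2(2) by force
    qed
    then have "quotient_dist (\<gamma> a) (\<gamma> \<tau>1) \<le> integral {a..\<tau>1} (speed \<gamma>)"
      "quotient_dist (\<gamma> \<tau>2) (\<gamma> b) \<le> integral {\<tau>2..b} (speed \<gamma>)"
      using le by (auto intro!: sub)
    moreover have "integral {\<tau>1..\<tau>2} (speed \<gamma>) \<ge> 0"
      by (simp add: integral_nonneg speed_nonneg intsub le)
    moreover have "integral {a..\<tau>1} (speed \<gamma>) + integral {\<tau>1..\<tau>2} (speed \<gamma>)
        = integral {a..\<tau>2} (speed \<gamma>)"
      "integral {a..\<tau>2} (speed \<gamma>) + integral {\<tau>2..b} (speed \<gamma>) = integral {a..b} (speed \<gamma>)"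
      using le by (intro Henstock_Kurzweil_Integration.integral_combine intsub; simp)+
    moreover have "\<gamma> \<tau>1 = \<gamma> \<tau>2" using \<tau>1 \<tau>2 by (simp add: Z_def)
    ultimately show ?thesis using quotient_dist_triangle[of "\<gamma> a" "\<gamma> b" "\<gamma> \<tau>1"] by simp
  qed
qed

lemma speed_measurable:
  assumes pw: "\<gamma> piecewise_C1_differentiable_on {a..b}"
  shows "(\<lambda>t. indicator {a..b} t * speed \<gamma> t) \<in> borel_measurable borel"
proof -
  from pw obtain S D where cont: "continuous_on {a..b} \<gamma>" and S: "finite S"
    and deriv: "\<And>t. t \<in> {a..b} - S \<Longrightarrow> (\<gamma> has_vector_derivative D t) (at t)"
    and contD: "continuous_on ({a..b} - S) D"
    unfolding piecewise_C1_differentiable_on_def C1_differentiable_on_def by blast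
  have sets: "{a..b} - S \<in> sets borel" using S
      by (intro sets.Diff borel_closed[OF finite_imp_closed[OF S]]) auto
  have "(\<lambda>t. indicator ({a..b} - S) t *\<^sub>R D t) \<in> borel_measurable borel"
    by (rule borel_measurable_continuous_on_indicator[OF sets contD])
  moreover have "(\<lambda>t. indicator ({a..b} - S) t *\<^sub>R \<gamma> t) \<in> borel_measurable borel"
    by (rule borel_measurable_continuous_on_indicator[OF sets continuous_on_subset[OF cont]]) auto
  ultimately have "(\<lambda>t. norm (indicator ({a..b} - S) t *\<^sub>R D t)
      / sqrt (2 * norm (indicator ({a..b} - S) t *\<^sub>R \<gamma> t))) \<in> borel_measurable borel"
    by measurable
  then show ?thesis
  proof (rule measurable_discrete_difference[where X = S])
    fix t assume "t \<notin> S"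
    then show "norm (indicator ({a..b} - S) t *\<^sub>R D t) / sqrt (2 * norm (indicator ({a..b} - S) t
        *\<^sub>R \<gamma> t))
        = indicator {a..b} t * speed \<gamma> t"
      using speed_eq[OF deriv, of t] by (auto simp: indicator_def)
  qed (use S in \<open>auto intro: countable_finite\<close>)
qed

text \<open>
  Lengths are Lebesgue integrals with values in \<open>[0, \<infinity>]\<close>; finite ones are gauge integrals, and
  the additivity and continuity of those in the end points serve in the arguments about arc
  length.
\<close>

lemma shape_length_finite:
  assumes pw: "\<gamma> piecewise_C1_differentiable_on {a..b}" and fin: "shape_length \<gamma> a b < \<infinity>"
  shows "speed \<gamma> integrable_on {a..b}" "shape_length \<gamma> a b = ennreal (integral {a..b} (speed \<gamma>))"
proof -
  have eq: "shape_length \<gamma> a b = (\<integral>\<^sup>+t. ennreal (indicator {a..b} t * speed \<gamma> t) \<partial>lborel)"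
    unfolding shape_length_eq
    by (intro nn_integral_cong) (auto simp: indicator_def)
  obtain r where r: "r \<ge> 0" "shape_length \<gamma> a b = ennreal r"
    using fin by (metis ennreal_cases infinity_ennreal_def less_irrefl)
  have "((\<lambda>t. indicator {a..b} t * speed \<gamma> t) has_integral r) UNIV"
    using speed_measurable[OF pw] r eq
    by (intro nn_integral_has_integral) (auto simp: speed_nonneg)
  moreover have "(\<lambda>t. indicator {a..b} t * speed \<gamma> t) = (\<lambda>t. if t \<in> {a..b} then speed \<gamma> t else 0)"
    by (auto simp: indicator_def)
  ultimately have "(speed \<gamma> has_integral r) {a..b}"
    by (simp only: has_integral_restrict_UNIV)
  then show "speed \<gamma> integrable_on {a..b}"
      "shape_length \<gamma> a b = ennreal (integral {a..b} (speed \<gamma>))"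
    using r by (auto simp: integral_unique integrable_on_def)
qed

lemma quotient_dist_le_shape_length:
  assumes "a \<le> b" "\<gamma> piecewise_C1_differentiable_on {a..b}"
  shows "ennreal (quotient_dist (\<gamma> a) (\<gamma> b)) \<le> shape_length \<gamma> a b"
proof (cases "shape_length \<gamma> a b < \<infinity>")
  case True
  then show ?thesis
    using shape_length_finite[OF assms(2)] quotient_dist_le_integral_speed[OF assms]
    by (simp add: ennreal_leI)
qed (simp add: less_top[symmetric])

lemma projected_line_deriv:
  "((\<lambda>t. rot_map (Z + t *\<^sub>R V)) has_vector_derivative rot_polar (Z + t *\<^sub>R V) V) (at t within S)"
  unfolding rot_map_line rot_polar_scale_left
  by (auto intro!: derivative_eq_intros simp: algebra_simps)

lemma projected_line_piecewise_C1:
  "(\<lambda>t. rot_map (Z + t *\<^sub>R V)) piecewise_C1_differentiable_on S"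
proof (rule C1_differentiable_imp_piecewise)
  have "continuous_on S (\<lambda>t. rot_polar (Z + t *\<^sub>R V) V)"
    unfolding rot_polar_scale_left by (intro continuous_intros)
  then show "(\<lambda>t. rot_map (Z + t *\<^sub>R V)) C1_differentiable_on S"
    unfolding C1_differentiable_on_def by (auto intro: projected_line_deriv)
qed

text \<open>
  A horizontal line passes through the origin at most once, which does not matter for the
  integral; elsewhere (if \<open>V \<noteq> 0\<close>) the stretching by \<open>\<bar>Z + t V\<bar>\<close> cancels against the conformal
  factor.
\<close>

lemma shape_length_projected_line:
  assumes hor: "Im (herm Z V) = 0" and ab: "a \<le> b"
  shows "shape_length (\<lambda>t. rot_map (Z + t *\<^sub>R V)) a b = ennreal (norm V * (b - a))"
proof -
  have sp: "speed (\<lambda>t. rot_map (Z + t *\<^sub>R V)) t = norm V" if "Z + t *\<^sub>R V \<noteq> 0" for t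
  proof -
    have "Im (herm (Z + t *\<^sub>R V) V) = 0" using hor by (simp add: herm_add_left herm_scale_left
        herm_self)
    then show ?thesis
      using that unfolding speed_eq[OF projected_line_deriv]
          by (simp add: norm_rot_polar norm_rot_map)
  qed
  have "\<exists>c. \<forall>t. t \<noteq> c \<longrightarrow> speed (\<lambda>t. rot_map (Z + t *\<^sub>R V)) t = norm V"
  proof (cases "\<exists>c. Z + c *\<^sub>R V = 0")
    case True
    then obtain c where c: "Z + c *\<^sub>R V = 0" by blast
    have "speed (\<lambda>t. rot_map (Z + t *\<^sub>R V)) t = norm V" if "t \<noteq> c" for t
    proof (cases "V = 0")
      case True
      then have "rot_polar (Z + t *\<^sub>R V) V = 0" by (simp add: rot_polar_def vec_eq_iff forall_3)
      with True show ?thesis unfolding speed_eq[OF projected_line_deriv] by simp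
    next
      case False
      have "Z + t *\<^sub>R V = (t - c) *\<^sub>R V" using c by (simp add: algebra_simps add_eq_0_iff)
      then show ?thesis using False that by (intro sp) simp
    qed
    then show ?thesis by blast
  qed (use sp in blast)
  then obtain c where c: "\<And>t. t \<noteq> c \<Longrightarrow> speed (\<lambda>t. rot_map (Z + t *\<^sub>R V)) t = norm V" by blast
  have "AE t in lborel. t \<noteq> c" by (rule AE_lborel_singleton)
  then have "AE t in lborel. speed (\<lambda>t. rot_map (Z + t *\<^sub>R V)) t = norm V"
    by eventually_elim (rule c)
  then have "shape_length (\<lambda>t. rot_map (Z + t *\<^sub>R V)) a b = (\<integral>\<^sup>+t. ennreal (norm V) * indicator
      {a..b} t \<partial>lborel)"
    unfolding shape_length_eq
    by (intro nn_integral_cong_AE) auto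
  also have "\<dots> = ennreal (norm V * (b - a))"
    using ab by (simp add: nn_integral_cmult_indicator ennreal_mult)
  finally show ?thesis .
qed

text \<open>
  The infimum is attained by the projected segment between aligned lifts.
\<close>

lemma riemannian_distance_eq: "riemannian_distance p p' = ennreal (quotient_dist p p')"
  unfolding riemannian_distance_def
proof (rule antisym)
  obtain Z where Z: "rot_map Z = p" using rot_map_surj by blast
  obtain W where W: "rot_map W = p'" "norm (Z - W) = quotient_dist p p'"
    using ex_aligned_lift[of p' Z] Z by blast
  have "herm Z W = of_real (cmod (herm Z W))"
    using quotient_dist_eq_norm_iff[of Z W] W Z by simp
  then have "Im (herm Z W) = 0" by (metis Im_complex_of_real)
  then have "Im (herm Z (W - Z)) = 0"
    using herm_add_right[of Z "W - Z" Z] by (simp add: herm_self)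
  then have len: "shape_length (\<lambda>t. rot_map (Z + t *\<^sub>R (W - Z))) 0 1 = ennreal (quotient_dist p p')"
    using W by (simp add: shape_length_projected_line norm_minus_commute)
  show "(INF \<gamma>\<in>{\<gamma>. valid_path \<gamma> \<and> pathstart \<gamma> = p \<and> pathfinish \<gamma> = p'}. shape_length \<gamma> 0 1)
      \<le> ennreal (quotient_dist p p')"
    unfolding len[symmetric]
    by (rule INF_lower)
       (simp add: valid_path_def pathstart_def pathfinish_def projected_line_piecewise_C1 Z W)
  show "ennreal (quotient_dist p p')
      \<le> (INF \<gamma>\<in>{\<gamma>. valid_path \<gamma> \<and> pathstart \<gamma> = p \<and> pathfinish \<gamma> = p'}. shape_length \<gamma> 0 1)"
    using quotient_dist_le_shape_length[of 0 1]
    by (intro INF_greatest) (auto simp: valid_path_def pathstart_def pathfinish_def)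
qed

section \<open>Geodesics are projected horizontal lines\<close>

lemma norm_add_eq_imp_collinear:
  fixes x y :: "'a :: real_inner"
  assumes "norm (x + y) = norm x + norm y"
  shows "norm (x + y) *\<^sub>R x = norm x *\<^sub>R (x + y)"
proof -
  have "norm x *\<^sub>R y = norm y *\<^sub>R x" using assms norm_triangle_eq by blast
  then show ?thesis unfolding assms by (simp add: algebra_simps)
qed

text \<open>
  Fix a lift \<open>Zc\<close> of the midpoint and an aligned lift \<open>Za\<close> of the initial point. A geodesic that
  can be prolonged beyond the midpoint does not reach the antipodal orbit there, so the product
  of \<open>Za\<close> with the lift of the midpoint is positive (unless \<open>Za = 0\<close>), and \<open>Za\<close> is the only
  aligned lift. For every other point of the arc, a chain of aligned lifts through that point
  then has the same fixed vectors \<open>Za\<close> and \<open>Zc\<close> in it, and its points are collinear because its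
  length is the distance of its ends.
\<close>

lemma isometric_arc_is_projected_line:
  assumes s: "s1 < s2"
    and iso: "\<And>x y. s1 \<le> x \<Longrightarrow> x \<le> y \<Longrightarrow> y \<le> s2 \<Longrightarrow> quotient_dist (\<Gamma> x) (\<Gamma> y) = y - x"
  shows "\<exists>Z V. norm V = 1 \<and> Im (herm Z V) = 0 \<and> (\<forall>x\<in>{s1..s2}. \<Gamma> x = rot_map (Z + x *\<^sub>R V))"
proof -
  define c where "c = (s1 + s2) / 2"
  have c: "s1 < c" "c < s2" "c - s1 = s2 - c" using s by (simp_all add: c_def field_simps)
  obtain Zc where Zc: "rot_map Zc = \<Gamma> c" using rot_map_surj by blast
  obtain Za where Za: "rot_map Za = \<Gamma> s1" "norm (Zc - Za) = c - s1"
    using ex_aligned_lift[of "\<Gamma> s1" Zc] iso[of s1 c] c by (auto simp: Zc quotient_dist_commute)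
  obtain Zb where Zb: "rot_map Zb = \<Gamma> s2" "norm (Zc - Zb) = s2 - c"
    using ex_aligned_lift[of "\<Gamma> s2" Zc] iso[of c s2] c by (auto simp: Zc)
  define V where "V = (1 / (c - s1)) *\<^sub>R (Zc - Za)"
  have Zc_eq: "Zc = Za + (c - s1) *\<^sub>R V" using c by (simp add: V_def)
  have normV: "norm V = 1" using c Za by (simp add: V_def)
  have dab: "norm (Zb - Za) = s2 - s1"
  proof (rule antisym)
    show "norm (Zb - Za) \<le> s2 - s1"
      using norm_triangle_ineq[of "Zb - Zc" "Zc - Za"] Za Zb by (simp add: norm_minus_commute)
    show "s2 - s1 \<le> norm (Zb - Za)"
      using quotient_dist_le_norm[of Za Zb] iso[of s1 s2] s Za Zb by (simp add: norm_minus_commute)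
  qed
  have "norm ((Zc - Za) + (Zb - Zc)) = norm (Zc - Za) + norm (Zb - Zc)"
    using dab Za Zb by (simp add: norm_minus_commute)
  from norm_add_eq_imp_collinear[OF this] have "(s2 - s1) *\<^sub>R (Zc - Za) = (c - s1) *\<^sub>R (Zb - Za)"
    using dab Za by simp
  moreover have "c - s1 = (s2 - s1) * (1 / 2)" by (simp add: c_def field_simps)
  ultimately have "(s2 - s1) *\<^sub>R (Zc - Za) = (s2 - s1) *\<^sub>R ((1 / 2) *\<^sub>R (Zb - Za))"
    by (simp only: scaleR_scaleR)
  then have "Zc - Za = (1 / 2) *\<^sub>R (Zb - Za)"
    using s by (simp only: scaleR_cancel_left) simp
  then have "Zc = (1 / 2) *\<^sub>R (Zb - Za) + Za" by (simp only: diff_eq_eq)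
  also have "\<dots> = (1 / 2) *\<^sub>R Zb - (1 / 2) *\<^sub>R Za + ((1 / 2) *\<^sub>R Za + (1 / 2) *\<^sub>R Za)"
    by (simp only: scaleR_diff_right scaleR_add_right[symmetric] scaleR_half_double)
  finally have mid: "Zc = (1 / 2) *\<^sub>R Za + (1 / 2) *\<^sub>R Zb" by simp
  have "quotient_dist (rot_map Za) (rot_map Zb) = norm (Za - Zb)"
    using dab iso[of s1 s2] s Za Zb by (simp add: norm_minus_commute)
  then have hab: "herm Za Zb = of_real (cmod (herm Za Zb))"
    by (simp add: quotient_dist_eq_norm_iff)
  define h where "h = ((norm Za)\<^sup>2 + cmod (herm Za Zb)) / 2"
  have hac: "herm Za Zc = of_real h"
  proof -
    have "herm Za Zc = of_real (1 / 2) * of_real ((norm Za)\<^sup>2) + of_real (1 / 2) * of_real (cmod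
        (herm Za Zb))"
      unfolding mid herm_add_right herm_scale_right herm_self hab[symmetric] ..
    also have "\<dots> = of_real h"
      unfolding of_real_add[symmetric] of_real_mult[symmetric] by (simp add: h_def field_simps)
    finally show ?thesis .
  qed
  \<comment> \<open>Another aligned lift is \<open>u Za\<close>, and alignment makes \<open>u h\<close> nonnegative, so \<open>u = 1\<close>.\<close>
  have Za_unique: "Y = Za" if Y: "rot_map Y = \<Gamma> s1" "norm (Y - Zc) = c - s1" for Y
  proof (cases "Za = 0")
    case True
    then show ?thesis using Y Za by (metis rot_map_eq_0_iff)
  next
    case False
    then have "h > 0" by (simp add: h_def add_pos_nonneg)
    obtain u where u: "cmod u = 1" "Y = phase u Za"
      using Y Za rot_map_eq_iff[of Y Za] by auto
    have "quotient_dist (rot_map Y) (rot_map Zc) = norm (Y - Zc)"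
      using Y Zc iso[of s1 c] c by simp
    then have "u * of_real h = of_real (cmod (u * of_real h))"
      unfolding quotient_dist_eq_norm_iff u(2) herm_phase_left hac .
    then have "u = 1" using u \<open>h > 0\<close> by (simp add: norm_mult)
    with u show ?thesis by simp
  qed
  have arc: "\<Gamma> t = rot_map (Za + (t - s1) *\<^sub>R V)" if t: "t \<in> {s1..s2}" for t
  proof (cases "t \<le> c")
    case True
    obtain Zt where Zt: "rot_map Zt = \<Gamma> t" "norm (Zc - Zt) = c - t"
      using ex_aligned_lift[of "\<Gamma> t" Zc] iso[of t c] c t True
          by (auto simp: Zc quotient_dist_commute)
    obtain Y where Y: "rot_map Y = \<Gamma> s1" "norm (Zt - Y) = t - s1"
      using ex_aligned_lift[of "\<Gamma> s1" Zt] iso[of s1 t] t by (auto simp: Zt quotient_dist_commute)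
    have "norm (Y - Zc) = c - s1"
    proof (rule antisym)
      show "norm (Y - Zc) \<le> c - s1"
        using norm_triangle_ineq[of "Y - Zt" "Zt - Zc"] Y Zt by (simp add: norm_minus_commute)
      show "c - s1 \<le> norm (Y - Zc)"
        using quotient_dist_le_norm[of Y Zc] iso[of s1 c] c Y Zc by simp
    qed
    then have "Y = Za" using Y Za_unique by blast
    then have "norm ((Zt - Za) + (Zc - Zt)) = norm (Zt - Za) + norm (Zc - Zt)"
      using Y Zt Za by simp
    from norm_add_eq_imp_collinear[OF this] have "(c - s1) *\<^sub>R (Zt - Za) = (t - s1) *\<^sub>R (Zc - Za)"
      using Y Za \<open>Y = Za\<close> by simp
    also have "\<dots> = (c - s1) *\<^sub>R ((t - s1) *\<^sub>R V)" by (simp add: Zc_eq)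
    finally have "Zt - Za = (t - s1) *\<^sub>R V" using c(1) by (simp only: scaleR_cancel_left) simp
    then have "Zt = Za + (t - s1) *\<^sub>R V" by (simp add: algebra_simps)
    then show ?thesis using Zt by simp
  next
    case False
    obtain Zt where Zt: "rot_map Zt = \<Gamma> t" "norm (Zc - Zt) = t - c"
      using ex_aligned_lift[of "\<Gamma> t" Zc] iso[of c t] c t False by (auto simp: Zc)
    have dat: "norm (Zt - Za) = t - s1"
    proof (rule antisym)
      show "norm (Zt - Za) \<le> t - s1"
        using norm_triangle_ineq[of "Zt - Zc" "Zc - Za"] Za Zt by (simp add: norm_minus_commute)
      show "t - s1 \<le> norm (Zt - Za)"
        using quotient_dist_le_norm[of Za Zt] iso[of s1 t] t Za Zt by (simp add: norm_minus_commute)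
    qed
    then have "norm ((Zc - Za) + (Zt - Zc)) = norm (Zc - Za) + norm (Zt - Zc)"
      using Zt Za by (simp add: norm_minus_commute)
    from norm_add_eq_imp_collinear[OF this] have "(c - s1) *\<^sub>R (Zt - Za) = (t - s1) *\<^sub>R (Zc - Za)"
      using dat Za by simp
    also have "\<dots> = (c - s1) *\<^sub>R ((t - s1) *\<^sub>R V)" by (simp add: Zc_eq)
    finally have "Zt - Za = (t - s1) *\<^sub>R V" using c(1) by (simp only: scaleR_cancel_left) simp
    then have "Zt = Za + (t - s1) *\<^sub>R V" by (simp add: algebra_simps)
    then show ?thesis using Zt by simp
  qed
  have "of_real h = of_real ((norm Za)\<^sup>2) + of_real (c - s1) * herm Za V"
    using hac unfolding Zc_eq herm_add_right herm_scale_right herm_self by simp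
  then have "Im (of_real h) = Im (of_real ((norm Za)\<^sup>2) + of_real (c - s1) * herm Za V)" by simp
  then have "Im (herm Za V) = 0" using c by simp
  then have "Im (herm (Za + (- s1) *\<^sub>R V) V) = 0"
    unfolding herm_add_left herm_scale_left herm_self by simp
  moreover have "\<Gamma> t = rot_map ((Za + (- s1) *\<^sub>R V) + t *\<^sub>R V)" if "t \<in> {s1..s2}" for t
    using arc[OF that] by (simp add: algebra_simps)
  ultimately show ?thesis using normV by blast
qed

lemma quadratic_eq_0:
  fixes P U W :: "'a :: real_vector"
  assumes "x \<noteq> y" "y \<noteq> z" "x \<noteq> z"
    and q: "P + x *\<^sub>R U + x\<^sup>2 *\<^sub>R W = 0" "P + y *\<^sub>R U + y\<^sup>2 *\<^sub>R W = 0" "P + z *\<^sub>R U + z\<^sup>2 *\<^sub>R W = 0"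
  shows "P = 0 \<and> U = 0 \<and> W = 0"
proof -
  have *: "U + (a + b) *\<^sub>R W = 0"
    if "a \<noteq> b" "P + a *\<^sub>R U + a\<^sup>2 *\<^sub>R W = 0" "P + b *\<^sub>R U + b\<^sup>2 *\<^sub>R W = 0" for a b
  proof -
    have "(a - b) *\<^sub>R (U + (a + b) *\<^sub>R W) = (P + a *\<^sub>R U + a\<^sup>2 *\<^sub>R W) - (P + b *\<^sub>R U + b\<^sup>2 *\<^sub>R W)"
      by (simp add: algebra_simps power2_eq_square)
    then show ?thesis using that by simp
  qed
  have "(y - z) *\<^sub>R W = (U + (x + y) *\<^sub>R W) - (U + (x + z) *\<^sub>R W)" by (simp add: algebra_simps)
  then have W: "W = 0" using * assms by simp
  then have "U = 0" using *[of x y] assms by simp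
  with W show ?thesis using q by simp
qed

lemma projected_lines_unique:
  assumes "x \<noteq> y"
    and eq: "\<And>s. s \<in> closed_segment x y \<Longrightarrow> rot_map (Z + s *\<^sub>R V) = rot_map (Z' + s *\<^sub>R V')"
  shows "rot_map (Z + t *\<^sub>R V) = rot_map (Z' + t *\<^sub>R V')"
proof -
  have q: "(rot_map Z - rot_map Z') + s *\<^sub>R (rot_polar Z V - rot_polar Z' V') + s\<^sup>2 *\<^sub>R (rot_map V -
      rot_map V')
      = rot_map (Z + s *\<^sub>R V) - rot_map (Z' + s *\<^sub>R V')" for s
    by (simp add: rot_map_line algebra_simps)
  have "rot_map Z - rot_map Z' = 0 \<and> rot_polar Z V - rot_polar Z' V' = 0 \<and> rot_map V - rot_map V'
      = 0"
  proof (rule quadratic_eq_0[of x y "midpoint x y"])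
    have "x \<in> closed_segment x y" "y \<in> closed_segment x y" "midpoint x y \<in> closed_segment x y"
        by auto
    then show "(rot_map Z - rot_map Z') + x *\<^sub>R (rot_polar Z V - rot_polar Z' V') + x\<^sup>2 *\<^sub>R (rot_map
        V - rot_map V') = 0"
      "(rot_map Z - rot_map Z') + y *\<^sub>R (rot_polar Z V - rot_polar Z' V') + y\<^sup>2 *\<^sub>R (rot_map V -
          rot_map V') = 0"
      "(rot_map Z - rot_map Z') + (midpoint x y) *\<^sub>R (rot_polar Z V - rot_polar Z' V') + (midpoint x
          y)\<^sup>2 *\<^sub>R (rot_map V - rot_map V') = 0"
      unfolding q using eq by simp_all
    show "y \<noteq> midpoint x y" "x \<noteq> midpoint x y"
      using assms(1) by (auto simp: midpoint_def field_simps)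
  qed (rule assms(1))
  then show ?thesis using q[of t] by simp
qed

text \<open>
  Lines chosen at nearby parameters have projections that agree on a nontrivial interval, hence
  everywhere; so the projected line is locally constant in the parameter. The condition on balls
  makes each arc a neighbourhood of \<open>s\<close> in \<open>J\<close>, including the case that \<open>s\<close> is an end point of
  \<open>J\<close>.
\<close>

lemma locally_isometric_is_projected_line:
  assumes J: "connected J" "J \<noteq> {}"
    and loc: "\<And>s. s \<in> J \<Longrightarrow> \<exists>s1 s2 e. s1 < s2 \<and> s1 \<le> s \<and> s \<le> s2 \<and> {s1..s2} \<subseteq> J \<and>
        e > 0 \<and> J \<inter> ball s e \<subseteq> {s1..s2} \<and>
        (\<forall>x y. s1 \<le> x \<and> x \<le> y \<and> y \<le> s2 \<longrightarrow> quotient_dist (\<Gamma> x) (\<Gamma> y) = y - x)"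
  shows "\<exists>Z V. norm V = 1 \<and> Im (herm Z V) = 0 \<and> (\<forall>s\<in>J. \<Gamma> s = rot_map (Z + s *\<^sub>R V))"
proof -
  define germ where "germ = (\<lambda>s Z V. \<exists>s1 s2 e. s1 < s2 \<and> s1 \<le> s \<and> s \<le> s2 \<and> {s1..s2} \<subseteq> J \<and>
      e > 0 \<and> J \<inter> ball s e \<subseteq> {s1..s2} \<and> (\<forall>x\<in>{s1..s2}. \<Gamma> x = rot_map (Z + x *\<^sub>R V)))"
  have "\<exists>p. norm (snd p) = 1 \<and> Im (herm (fst p) (snd p)) = 0 \<and> germ s (fst p) (snd p)"
    if s: "s \<in> J" for s
  proof -
    obtain s1 s2 e where *: "s1 < s2" "s1 \<le> s" "s \<le> s2" "{s1..s2} \<subseteq> J" "e > 0"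
        "J \<inter> ball s e \<subseteq> {s1..s2}"
      "\<And>x y. s1 \<le> x \<Longrightarrow> x \<le> y \<Longrightarrow> y \<le> s2 \<Longrightarrow> quotient_dist (\<Gamma> x) (\<Gamma> y) = y - x"
      using loc[OF s] by blast
    obtain Z V where "norm V = 1" "Im (herm Z V) = 0" "\<forall>x\<in>{s1..s2}. \<Gamma> x = rot_map (Z + x *\<^sub>R V)"
      using isometric_arc_is_projected_line[OF *(1,7)] by blast
    moreover from this(3) have "germ s Z V"
      unfolding germ_def by (intro exI[of _ s1] exI[of _ s2] exI[of _ e]) (simp add: * del:
          atLeastatMost_subset_iff)
    ultimately show ?thesis by (intro exI[of _ "(Z, V)"]) simp
  qed
  then have "\<forall>s\<in>J. \<exists>p. norm (snd p) = 1 \<and> Im (herm (fst p) (snd p)) = 0 \<and> germ s (fst p) (snd p)"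
    by blast
  from bchoice[OF this] obtain F where
    F: "\<And>s. s \<in> J \<Longrightarrow> norm (snd (F s)) = 1" "\<And>s. s \<in> J \<Longrightarrow> Im (herm (fst (F s)) (snd (F s))) = 0"
      "\<And>s. s \<in> J \<Longrightarrow> germ s (fst (F s)) (snd (F s))"
    by blast
  define line where "line = (\<lambda>s t. rot_map (fst (F s) + t *\<^sub>R snd (F s)))"
  obtain s0 where s0: "s0 \<in> J" using J by blast
  have "line s0 = line s" if s: "s \<in> J" for s
  proof (rule connected_equivalence_relation[OF J(1) s0 s])
    fix s assume s: "s \<in> J"
    obtain s1 s2 e where s12: "s1 < s2" "{s1..s2} \<subseteq> J" "e > 0" "J \<inter> ball s e \<subseteq> {s1..s2}"
      and eq: "\<And>x. x \<in> {s1..s2} \<Longrightarrow> \<Gamma> x = line s x"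
      using F(3)[OF s] unfolding germ_def line_def by blast
    have "line s = line x" if x: "x \<in> J \<inter> ball s e" for x
    proof -
      have xJ: "x \<in> J" and xs: "x \<in> {s1..s2}" using x s12(4) by auto
      obtain x1 x2 d where d: "d > 0" "J \<inter> ball x d \<subseteq> {x1..x2}"
        and eqx: "\<And>t. t \<in> {x1..x2} \<Longrightarrow> \<Gamma> t = line x t"
        using F(3)[OF xJ] unfolding germ_def line_def by blast
      \<comment> \<open>Any second parameter of both arcs will do; the step \<open>d / 2\<close> keeps it inside the ball around \<open>x\<close>.\<close>
      define y where "y = (if x < s2 then min s2 (x + d / 2) else max s1 (x - d / 2))"
      have y: "y \<noteq> x" "y \<in> {s1..s2}" "\<bar>y - x\<bar> < d"
        using xs s12(1) d(1) by (auto simp: y_def min_def max_def)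
      have agree: "line s t = line x t" if t: "t \<in> closed_segment x y" for t
      proof -
        have ts: "t \<in> {s1..s2}"
          using t xs y by (auto simp: closed_segment_eq_real_ivl split: if_splits)
        have "t \<in> ball x d"
          using t y by (auto simp: closed_segment_eq_real_ivl dist_real_def split: if_splits)
        then have "t \<in> {x1..x2}" using ts s12(2) d(2) by blast
        then show ?thesis using eq[OF ts] eqx by simp
      qed
      show ?thesis
        unfolding line_def
        by (rule ext, rule projected_lines_unique[OF y(1)[symmetric]]) (use agree in \<open>simp add:
            line_def\<close>)
    qed
    then show "\<exists>T. openin (top_of_set J) T \<and> s \<in> T \<and> (\<forall>x\<in>T. line s = line x)"
      using s s12(3) by (intro exI[of _ "J \<inter> ball s e"]) (auto simp: openin_open_Int)
  qed auto
  moreover have "\<Gamma> s = line s s" if s: "s \<in> J" for s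
    using F(3)[OF s] unfolding germ_def line_def by auto
  ultimately have "\<forall>s\<in>J. \<Gamma> s = rot_map (fst (F s0) + s *\<^sub>R snd (F s0))"
    unfolding line_def by metis
  with F(1,2)[OF s0] show ?thesis by blast
qed

lemma continuous_on_interval_if_compact_intervals:
  fixes f :: "real \<Rightarrow> 'a :: metric_space"
  assumes I: "is_interval I" and cont: "\<And>a b. {a..b} \<subseteq> I \<Longrightarrow> a \<le> b \<Longrightarrow> continuous_on {a..b} f"
  shows "continuous_on I f"
  unfolding continuous_on_sequentially
proof (intro allI ballI impI)
  fix x l assume l: "l \<in> I" and x: "(\<forall>n. x n \<in> I) \<and> x \<longlonglongrightarrow> l"
  define K where "K = insert l (range x)"
  have "compact K" "K \<noteq> {}" "K \<subseteq> I"
    using x l compact_sequence_with_limit[of x l] by (auto simp: K_def)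
  obtain a where a: "a \<in> K" "\<And>t. t \<in> K \<Longrightarrow> a \<le> t"
    using compact_attains_inf[OF \<open>compact K\<close> \<open>K \<noteq> {}\<close>] by blast
  obtain b where b: "b \<in> K" "\<And>t. t \<in> K \<Longrightarrow> t \<le> b"
    using compact_attains_sup[OF \<open>compact K\<close> \<open>K \<noteq> {}\<close>] by blast
  note ab = a(1) b(1) conjI[OF a(2) b(2)]
  have "{a..b} \<subseteq> I"
    using connected_contains_Icc[OF is_interval_connected[OF I]] a(1) b(1) \<open>K \<subseteq> I\<close> by blast
  moreover have "a \<le> b" using ab by blast
  ultimately have "continuous_on {a..b} f" by (rule cont)
  moreover have "l \<in> {a..b}" "\<forall>n. x n \<in> {a..b}" using ab(3) by (auto simp: K_def)
  ultimately show "(f \<circ> x) \<longlonglongrightarrow> f l"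
    using x unfolding continuous_on_sequentially by blast
qed

text \<open>
  The parameter is the signed length measured from a base point. It need not be injective, since
  a geodesic may pause.
\<close>

lemma geodesic_arclength_parameter:
  assumes geo: "geodesic_on I \<gamma>"
  shows "\<exists>\<phi>. continuous_on I \<phi> \<and> mono_on I \<phi> \<and>
     (\<forall>a\<in>I. \<forall>b\<in>I. a \<le> b \<longrightarrow> quotient_dist (\<gamma> a) (\<gamma> b) \<le> \<phi> b - \<phi> a) \<and>
     (\<forall>t\<in>I. \<exists>\<epsilon>>0. \<forall>a\<in>I. \<forall>b\<in>I. a \<le> t \<and> t \<le> b \<and> \<phi> b - \<phi> a < \<epsilon> \<longrightarrow>
        quotient_dist (\<gamma> a) (\<gamma> b) = \<phi> b - \<phi> a)"
proof (cases "I = {}")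
  case False
  then obtain t0 where t0: "t0 \<in> I" by blast
  have I: "is_interval I"
    and pw: "\<And>a b. a \<le> b \<Longrightarrow> {a..b} \<subseteq> I \<Longrightarrow> \<gamma> piecewise_C1_differentiable_on {a..b}"
    and fin: "\<And>a b. a \<le> b \<Longrightarrow> {a..b} \<subseteq> I \<Longrightarrow> shape_length \<gamma> a b < \<infinity>"
    and min: "\<And>t. t \<in> I \<Longrightarrow> \<exists>\<epsilon>>0. \<forall>a b. a \<le> t \<and> t \<le> b \<and> {a..b} \<subseteq> I \<and> shape_length \<gamma> a b < \<epsilon> \<longrightarrow>
        length_minimizer \<gamma> a b"
    using geo unfolding geodesic_on_def by blast+
  have sub: "{a..b} \<subseteq> I" if "a \<in> I" "b \<in> I" for a b
    by (rule connected_contains_Icc[OF is_interval_connected[OF I] that])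
  let ?f = "speed \<gamma>"
  have int: "?f integrable_on {a..b}" if "a \<in> I" "b \<in> I" for a b
  proof (cases "a \<le> b")
    case True then show ?thesis using shape_length_finite(1)[OF pw fin] sub that by blast
  qed (simp add: integrable_on_empty)
  define \<phi> where "\<phi> = (\<lambda>t. if t0 \<le> t then integral {t0..t} ?f else - integral {t..t0} ?f)"
  have comb: "integral {a..b} ?f + integral {b..c} ?f = integral {a..c} ?f"
    if "a \<in> I" "c \<in> I" "a \<le> b" "b \<le> c" for a b c
    using that by (intro Henstock_Kurzweil_Integration.integral_combine int) auto
  have \<phi>: "\<phi> b - \<phi> a = integral {a..b} ?f" if "a \<in> I" "b \<in> I" "a \<le> b" for a b
    using comb[of t0 b a] comb[of a b t0] comb[of a t0 b] that t0 by (auto simp: \<phi>_def)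
  have len: "shape_length \<gamma> a b = ennreal (\<phi> b - \<phi> a)" if "a \<in> I" "b \<in> I" "a \<le> b" for a b
    using shape_length_finite(2)[OF pw fin] sub that \<phi>[OF that] by simp
  have mono: "\<phi> a \<le> \<phi> b" if "a \<in> I" "b \<in> I" "a \<le> b" for a b
    using \<phi>[OF that] integral_nonneg[OF int[OF that(1,2)]] by (simp add: speed_nonneg)
  have le: "quotient_dist (\<gamma> a) (\<gamma> b) \<le> \<phi> b - \<phi> a" if "a \<in> I" "b \<in> I" "a \<le> b" for a b
    using quotient_dist_le_integral_speed[OF that(3) pw int] sub that \<phi> by simp
  have "continuous_on I \<phi>"
  proof (rule continuous_on_interval_if_compact_intervals[OF I])
    fix a b assume ab: "{a..b} \<subseteq> I" "a \<le> b"
    then have "a \<in> I" "b \<in> I" by auto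
    have "continuous_on {a..b} (\<lambda>t. \<phi> a + integral {a..t} ?f)"
      by (intro continuous_intros indefinite_integral_continuous_1 int \<open>a \<in> I\<close> \<open>b \<in> I\<close>)
    then show "continuous_on {a..b} \<phi>"
    proof (rule continuous_on_cong[THEN iffD1, rotated -1])
      fix t assume "t \<in> {a..b}"
      then show "\<phi> a + integral {a..t} ?f = \<phi> t" using \<phi>[of a t] ab \<open>a \<in> I\<close> by auto
    qed simp
  qed
  moreover have "\<exists>\<epsilon>>0. \<forall>a\<in>I. \<forall>b\<in>I. a \<le> t \<and> t \<le> b \<and> \<phi> b - \<phi> a < \<epsilon> \<longrightarrow>
        quotient_dist (\<gamma> a) (\<gamma> b) = \<phi> b - \<phi> a" if t: "t \<in> I" for t
  proof -
    obtain \<epsilon> :: ennreal where \<epsilon>: "\<epsilon> > 0"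
      "\<And>a b. a \<le> t \<Longrightarrow> t \<le> b \<Longrightarrow> {a..b} \<subseteq> I \<Longrightarrow> shape_length \<gamma> a b < \<epsilon> \<Longrightarrow> length_minimizer \<gamma> a b"
      using min[OF t] by blast
    obtain r where r: "r > 0" "ennreal r \<le> \<epsilon>"
    proof (cases \<epsilon> rule: ennreal_cases)
      case (real r)
      then show ?thesis using \<epsilon>(1) that by (intro that[of r]) auto
    next
      case top
      then show ?thesis by (intro that[of 1]) auto
    qed
    have "quotient_dist (\<gamma> a) (\<gamma> b) = \<phi> b - \<phi> a"
      if ab: "a \<in> I" "b \<in> I" "a \<le> t \<and> t \<le> b \<and> \<phi> b - \<phi> a < r" for a b
    proof -
      have "a \<le> b" using ab by simp
      have "shape_length \<gamma> a b < ennreal r"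
        using ab len[OF ab(1,2) \<open>a \<le> b\<close>] mono[OF ab(1,2) \<open>a \<le> b\<close>] by (simp add: ennreal_lessI r)
      then have "length_minimizer \<gamma> a b"
        using ab r(2) by (intro \<epsilon>(2) sub) (auto intro: less_le_trans)
      then have "ennreal (\<phi> b - \<phi> a) = ennreal (quotient_dist (\<gamma> a) (\<gamma> b))"
        unfolding length_minimizer_def riemannian_distance_eq len[OF ab(1,2) \<open>a \<le> b\<close>] by simp
      then show ?thesis using mono[OF ab(1,2) \<open>a \<le> b\<close>] quotient_dist_nonneg by simp
    qed
    with r(1) show ?thesis by blast
  qed
  ultimately show ?thesis using mono le by (intro exI[of _ \<phi>]) (auto simp: mono_on_def)
qed (intro exI[of _ "\<lambda>_. 0"], auto simp: mono_on_def)

text \<open>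
  A geodesic is constant where its arc length parameter is, so it factors through a curve \<open>\<Gamma>\<close> on
  the range \<open>J\<close> of the parameter. By the triangle inequality a minimising arc is isometric on
  all of its subarcs, and \<open>\<Gamma>\<close> is locally isometric.
\<close>

lemma geodesic_is_projected_line:
  assumes geo: "geodesic_on I \<gamma>"
  shows "\<exists>Z V \<phi>. V \<noteq> 0 \<and> Im (herm Z V) = 0 \<and> continuous_on I \<phi> \<and> mono_on I \<phi> \<and>
      (\<forall>t\<in>I. \<gamma> t = rot_map (Z + \<phi> t *\<^sub>R V))"
proof -
  obtain \<phi> where cont: "continuous_on I \<phi>" and mono: "mono_on I \<phi>"
    and le: "\<And>a b. a \<in> I \<Longrightarrow> b \<in> I \<Longrightarrow> a \<le> b \<Longrightarrow> quotient_dist (\<gamma> a) (\<gamma> b) \<le> \<phi> b - \<phi> a"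
    and loc: "\<And>t. t \<in> I \<Longrightarrow> \<exists>\<epsilon>>0. \<forall>a\<in>I. \<forall>b\<in>I. a \<le> t \<and> t \<le> b \<and> \<phi> b - \<phi> a < \<epsilon> \<longrightarrow>
        quotient_dist (\<gamma> a) (\<gamma> b) = \<phi> b - \<phi> a"
    using geodesic_arclength_parameter[OF geo] by blast
  have I: "is_interval I" using geo unfolding geodesic_on_def by blast
  have monoD: "\<phi> a \<le> \<phi> b" if "a \<in> I" "b \<in> I" "a \<le> b" for a b
    using mono that by (simp add: mono_on_def)
  define \<Gamma> where "\<Gamma> = (\<lambda>s. \<gamma> (inv_into I \<phi> s))"
  have factor: "\<gamma> a = \<gamma> b" if "a \<in> I" "b \<in> I" "\<phi> a = \<phi> b" for a b
  proof -
    have "quotient_dist (\<gamma> a) (\<gamma> b) \<le> 0"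
    proof (cases "a \<le> b")
      case True
      then show ?thesis using le[of a b] that by simp
    next
      case False
      then show ?thesis using le[of b a] that by (simp add: quotient_dist_commute[of "\<gamma> a"])
    qed
    then have "quotient_dist (\<gamma> a) (\<gamma> b) = 0" using quotient_dist_nonneg by (rule antisym)
    then show ?thesis by (rule quotient_dist_eq_0_iff[THEN iffD1])
  qed
  have \<Gamma>: "\<gamma> t = \<Gamma> (\<phi> t)" if "t \<in> I" for t
    unfolding \<Gamma>_def by (rule factor) (use that in \<open>simp_all add: f_inv_into_f inv_into_into\<close>)
  define J where "J = \<phi> ` I"
  have J: "connected J" unfolding J_def using cont I by (simp add: connected_continuous_image
      is_interval_connected)
  then have intJ: "\<And>x y. x \<in> J \<Longrightarrow> y \<in> J \<Longrightarrow> {x..y} \<subseteq> J"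
    by (simp add: connected_contains_Icc)
  show ?thesis
  proof (cases "\<exists>s0. J \<subseteq> {s0}")
    case True
    then obtain s0 where s0: "\<And>t. t \<in> I \<Longrightarrow> \<phi> t = s0" unfolding J_def by blast
    obtain Z where Z: "rot_map Z = \<Gamma> s0" using rot_map_surj by blast
    \<comment> \<open>For a constant curve any horizontal direction serves.\<close>
    define V where "V = (if Z = 0 then (1, 0) else Z)"
    have "V \<noteq> 0" "Im (herm Z V) = 0" by (auto simp: V_def herm_self herm_def zero_prod_def)
    moreover have "\<forall>t\<in>I. \<gamma> t = rot_map (Z + (0::real) *\<^sub>R V)" using \<Gamma> s0 Z by simp
    ultimately show ?thesis
      by (intro exI[of _ Z] exI[of _ V] exI[of _ "\<lambda>_. 0"]) (simp add: mono_on_def)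
  next
    case False
    have "\<exists>Z V. norm V = 1 \<and> Im (herm Z V) = 0 \<and> (\<forall>s\<in>J. \<Gamma> s = rot_map (Z + s *\<^sub>R V))"
    proof (rule locally_isometric_is_projected_line[OF J])
      show "J \<noteq> {}" using False by blast
    next
      fix s assume "s \<in> J"
      then obtain t where t: "t \<in> I" "\<phi> t = s" unfolding J_def by blast
      obtain \<epsilon> where \<epsilon>: "\<epsilon> > 0" "\<And>a b. a \<in> I \<Longrightarrow> b \<in> I \<Longrightarrow> a \<le> t \<Longrightarrow> t \<le> b \<Longrightarrow> \<phi> b - \<phi> a < \<epsilon> \<Longrightarrow>
        quotient_dist (\<gamma> a) (\<gamma> b) = \<phi> b - \<phi> a"
        using loc[OF t(1)] by blast
      \<comment> \<open>The left end of a short arc around \<open>t\<close>; it is \<open>t\<close> itself if \<open>s\<close> is the least element of \<open>J\<close>.\<close>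
      have "\<exists>a e1. a \<in> I \<and> a \<le> t \<and> \<phi> a > s - \<epsilon> / 2 \<and> e1 > 0 \<and> (\<forall>x\<in>J. s - e1 < x \<longrightarrow> \<phi> a \<le> x)
          \<and> ((\<exists>x\<in>J. x < s) \<longrightarrow> \<phi> a < s)"
      proof (cases "\<exists>x\<in>J. x < s")
        case True
        then obtain x where x: "x \<in> J" "x < s" by blast
        define s1 where "s1 = max x (s - \<epsilon> / 3)"
        have s1: "s1 < s" "s1 > s - \<epsilon> / 2" using x \<epsilon>(1) by (auto simp: s1_def)
        have "s1 \<in> J" using intJ[OF x(1) \<open>s \<in> J\<close>] x \<epsilon>(1) by (auto simp: s1_def max_def)
        then obtain a where a: "a \<in> I" "\<phi> a = s1" unfolding J_def by blast
        have "a \<le> t"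
        proof (rule ccontr)
          assume "\<not> a \<le> t"
          then have "\<phi> t \<le> \<phi> a" using monoD[OF t(1) a(1)] by simp
          then show False using a t s1 by simp
        qed
        with a s1 show ?thesis by (intro exI[of _ a] exI[of _ "s - s1"]) auto
      next
        case False
        then have "\<forall>x\<in>J. s \<le> x" by auto
        with t \<epsilon>(1) False show ?thesis by (intro exI[of _ t] exI[of _ 1]) auto
      qed
      then obtain a e1 where a: "a \<in> I" "a \<le> t" "\<phi> a > s - \<epsilon> / 2" "e1 > 0"
          "\<And>x. x \<in> J \<Longrightarrow> s - e1 < x \<Longrightarrow> \<phi> a \<le> x"
          "(\<exists>x\<in>J. x < s) \<Longrightarrow> \<phi> a < s" by blast
      have "\<exists>b e2. b \<in> I \<and> t \<le> b \<and> \<phi> b < s + \<epsilon> / 2 \<and> e2 > 0 \<and> (\<forall>x\<in>J. x < s + e2 \<longrightarrow> x \<le> \<phi> b)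
          \<and> ((\<exists>x\<in>J. x > s) \<longrightarrow> \<phi> b > s)"
      proof (cases "\<exists>x\<in>J. x > s")
        case True
        then obtain x where x: "x \<in> J" "s < x" by blast
        define s2 where "s2 = min x (s + \<epsilon> / 3)"
        have s2: "s < s2" "s2 < s + \<epsilon> / 2" using x \<epsilon>(1) by (auto simp: s2_def)
        have "s2 \<in> J" using intJ[OF \<open>s \<in> J\<close> x(1)] x \<epsilon>(1) by (auto simp: s2_def min_def)
        then obtain b where b: "b \<in> I" "\<phi> b = s2" unfolding J_def by blast
        have "t \<le> b"
        proof (rule ccontr)
          assume "\<not> t \<le> b"
          then have "\<phi> b \<le> \<phi> t" using monoD[OF b(1) t(1)] by simp
          then show False using b t s2 by simp
        qed
        with b s2 show ?thesis by (intro exI[of _ b] exI[of _ "s2 - s"]) auto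
      next
        case False
        then have "\<forall>x\<in>J. x \<le> s" by auto
        with t \<epsilon>(1) False show ?thesis by (intro exI[of _ t] exI[of _ 1]) auto
      qed
      then obtain b e2 where b: "b \<in> I" "t \<le> b" "\<phi> b < s + \<epsilon> / 2" "e2 > 0"
          "\<And>x. x \<in> J \<Longrightarrow> x < s + e2 \<Longrightarrow> x \<le> \<phi> b"
          "(\<exists>x\<in>J. x > s) \<Longrightarrow> \<phi> b > s" by blast
      have s12: "\<phi> a \<le> s" "s \<le> \<phi> b" using monoD a b t by auto
      obtain x where "x \<in> J" "x \<noteq> s" using False by blast
      then have "x < s \<or> s < x" by auto
      then have "\<phi> a < s \<or> s < \<phi> b" using a(6) b(6) \<open>x \<in> J\<close> by blast
      then have "\<phi> a < \<phi> b" using s12 by auto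
      have ab: "quotient_dist (\<gamma> a) (\<gamma> b) = \<phi> b - \<phi> a" using a b by (intro \<epsilon>(2)) auto
      have iso: "quotient_dist (\<Gamma> x) (\<Gamma> y) = y - x" if xy: "\<phi> a \<le> x \<and> x \<le> y \<and> y \<le> \<phi> b" for x y
      proof (cases "x = y")
        case True then show ?thesis by (simp add: quotient_dist_eq_0_iff[THEN iffD2])
      next
        case False
        have sub: "{a..b} \<subseteq> I" by (rule connected_contains_Icc[OF is_interval_connected[OF I] a(1)
            b(1)])
        have "continuous_on {a..b} \<phi>" by (rule continuous_on_subset[OF cont sub])
        then have IVT: "\<exists>t. a \<le> t \<and> t \<le> b \<and> \<phi> t = z" if "\<phi> a \<le> z" "z \<le> \<phi> b" for z
          using IVT'[of \<phi> a z b] that a(2) b(2) by simp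
        obtain tx where tx: "a \<le> tx" "tx \<le> b" "\<phi> tx = x" using IVT[of x] xy by auto
        obtain ty where ty: "a \<le> ty" "ty \<le> b" "\<phi> ty = y" using IVT[of y] xy by auto
        have txy: "tx \<in> I" "ty \<in> I" using tx ty sub by auto
        have "tx \<le> ty"
        proof (rule ccontr)
          assume "\<not> tx \<le> ty"
          then have "y \<le> x" using monoD[OF txy(2,1)] tx ty by simp
          then show False using xy False by simp
        qed
        have "quotient_dist (\<gamma> a) (\<gamma> b) \<le> quotient_dist (\<gamma> a) (\<gamma> tx) + (quotient_dist (\<gamma> tx) (\<gamma> ty)
            + quotient_dist (\<gamma> ty) (\<gamma> b))"
          using quotient_dist_triangle[of "\<gamma> a" "\<gamma> b" "\<gamma> tx"] quotient_dist_triangle[of "\<gamma> tx" "\<gamma> b"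
              "\<gamma> ty"] by simp
        then have "quotient_dist (\<gamma> tx) (\<gamma> ty) = \<phi> ty - \<phi> tx"
          using ab le[OF a(1) txy(1) tx(1)] le[OF txy \<open>tx \<le> ty\<close>] le[OF txy(2) b(1) ty(2)] by simp
        then show ?thesis using \<Gamma> txy tx ty by simp
      qed
      show "\<exists>s1 s2 e. s1 < s2 \<and> s1 \<le> s \<and> s \<le> s2 \<and> {s1..s2} \<subseteq> J \<and>
        e > 0 \<and> J \<inter> ball s e \<subseteq> {s1..s2} \<and>
        (\<forall>x y. s1 \<le> x \<and> x \<le> y \<and> y \<le> s2 \<longrightarrow> quotient_dist (\<Gamma> x) (\<Gamma> y) = y - x)"
      proof (intro exI conjI)
        show "{\<phi> a..\<phi> b} \<subseteq> J" using a b by (intro intJ) (auto simp: J_def)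
        show "J \<inter> ball s (min e1 e2) \<subseteq> {\<phi> a..\<phi> b}"
        proof
          fix x assume "x \<in> J \<inter> ball s (min e1 e2)"
          then have "x \<in> J" "s - e1 < x" "x < s + e2" by (auto simp: dist_real_def)
          then show "x \<in> {\<phi> a..\<phi> b}" using a(5) b(5) by simp
        qed
      qed (use \<open>\<phi> a < \<phi> b\<close> s12 a(4) b(4) iso in auto)
    qed
    then obtain Z V where ZV: "norm V = 1" "Im (herm Z V) = 0"
        "\<And>s. s \<in> J \<Longrightarrow> \<Gamma> s = rot_map (Z + s *\<^sub>R V)"
      by blast
    have "V \<noteq> 0" using ZV(1) by auto
    moreover have "\<forall>t\<in>I. \<gamma> t = rot_map (Z + \<phi> t *\<^sub>R V)"
      using \<Gamma> ZV(3) by (simp add: J_def)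
    ultimately show ?thesis using cont mono ZV(2) by blast
  qed
qed

text \<open>
  The points with parameters \<open>a \<le> b\<close> are aligned when their Hermitian product is nonnegative.
  Around a point away from the origin this holds for arcs shorter than half its norm. At the
  origin the projected line runs back along the ray on which it came, so this point may only be
  an end point of the interval, and there the product vanishes.
\<close>

lemma projected_line_is_geodesic:
  assumes I: "is_interval I" and hor: "Im (herm Z V) = 0" and V: "V \<noteq> 0"
    and nz: "\<And>t. t \<in> interior I \<Longrightarrow> Z + t *\<^sub>R V \<noteq> 0"
  shows "geodesic_on I (\<lambda>t. rot_map (Z + t *\<^sub>R V))"
proof -
  have minimal: "length_minimizer (\<lambda>t. rot_map (Z + t *\<^sub>R V)) a b"
    if ab: "a \<le> b" and pos: "Re (herm (Z + a *\<^sub>R V) (Z + b *\<^sub>R V)) \<ge> 0" for a b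
  proof -
    have "Im (herm V Z) = 0" using hor herm_cnj[of V Z] by simp
    then have "Im (herm (Z + a *\<^sub>R V) (Z + b *\<^sub>R V)) = 0"
      using hor by (simp add: herm_add_left herm_add_right herm_scale_left herm_scale_right
          herm_self)
    then have "herm (Z + a *\<^sub>R V) (Z + b *\<^sub>R V) = of_real (cmod (herm (Z + a *\<^sub>R V) (Z + b *\<^sub>R V)))"
      using pos by (simp add: complex_eq_iff cmod_def)
    then have "quotient_dist (rot_map (Z + a *\<^sub>R V)) (rot_map (Z + b *\<^sub>R V))
        = norm ((Z + a *\<^sub>R V) - (Z + b *\<^sub>R V))"
      by (rule quotient_dist_eq_norm_iff[THEN iffD2])
    also have "\<dots> = norm ((a - b) *\<^sub>R V)" by (simp add: algebra_simps)
    also have "\<dots> = norm V * (b - a)" using ab by simp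
    finally show ?thesis
      using ab hor by (simp add: length_minimizer_def projected_line_piecewise_C1
          shape_length_projected_line
          riemannian_distance_eq)
  qed
  have "\<exists>\<epsilon>>0. \<forall>a b. a \<le> t \<and> t \<le> b \<and> {a..b} \<subseteq> I \<and> shape_length (\<lambda>t. rot_map (Z + t *\<^sub>R V)) a b < \<epsilon> \<longrightarrow>
      length_minimizer (\<lambda>t. rot_map (Z + t *\<^sub>R V)) a b" if "t \<in> I" for t
  proof (cases "Z + t *\<^sub>R V = 0")
    case True
    have "length_minimizer (\<lambda>t. rot_map (Z + t *\<^sub>R V)) a b" if ab: "a \<le> t" "t \<le> b" "{a..b} \<subseteq> I" for
        a b
    proof (rule minimal)
      have "a = t \<or> b = t"
      proof (rule ccontr)
        assume "\<not> (a = t \<or> b = t)"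
        then have "t \<in> {a<..<b}" using ab by auto
        moreover have "{a<..<b} \<subseteq> interior I" using ab(3) by (intro interior_maximal) auto
        ultimately show False using nz True by blast
      qed
      then have "Z + a *\<^sub>R V = 0 \<or> Z + b *\<^sub>R V = 0" using True by blast
      moreover have "herm X Y = 0" if "X = 0 \<or> Y = 0" for X Y using that by (auto simp: herm_def)
      ultimately have "herm (Z + a *\<^sub>R V) (Z + b *\<^sub>R V) = 0" by blast
      then show "Re (herm (Z + a *\<^sub>R V) (Z + b *\<^sub>R V)) \<ge> 0" by simp
    qed (use ab in simp)
    then show ?thesis by (intro exI[of _ 1]) auto
  next
    case False
    define \<epsilon> where "\<epsilon> = norm (Z + t *\<^sub>R V) / 2"
    have "\<epsilon> > 0" using False by (simp add: \<epsilon>_def)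
    have "length_minimizer (\<lambda>t. rot_map (Z + t *\<^sub>R V)) a b"
      if ab: "a \<le> t" "t \<le> b" and len: "shape_length (\<lambda>t. rot_map (Z + t *\<^sub>R V)) a b < ennreal \<epsilon>" for
          a b
    proof (rule minimal)
      let ?A = "Z + a *\<^sub>R V" and ?B = "Z + b *\<^sub>R V"
      have lt: "norm V * (b - a) < \<epsilon>"
        using len ab \<open>\<epsilon> > 0\<close> hor by (simp add: shape_length_projected_line ennreal_less_iff)
      have "?A - ?B = (a - b) *\<^sub>R V" by (simp add: algebra_simps)
      then have AB: "norm (?A - ?B) = norm V * (b - a)" using ab by simp
      have "Z + t *\<^sub>R V = ?A + (t - a) *\<^sub>R V" by (simp add: algebra_simps)
      then have "norm (Z + t *\<^sub>R V) \<le> norm ?A + norm ((t - a) *\<^sub>R V)"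
        by (simp only: norm_triangle_ineq)
      also have "norm ((t - a) *\<^sub>R V) = norm V * (t - a)" using ab by simp
      finally have "norm (Z + t *\<^sub>R V) \<le> norm ?A + norm V * (t - a)" .
      moreover have "norm V * (t - a) \<le> norm V * (b - a)" using ab by (intro mult_left_mono) auto
      ultimately have "norm (?A - ?B) \<le> norm ?A" using lt AB by (simp add: \<epsilon>_def)
      then have "(norm (?A - ?B))\<^sup>2 \<le> (norm ?A)\<^sup>2" by (intro power_mono) auto
      then show "Re (herm ?A ?B) \<ge> 0"
        using norm_diff_sq_herm[of ?A ?B] by (smt (verit) zero_le_power2)
    qed (use ab in simp)
    then show ?thesis using \<open>\<epsilon> > 0\<close> by (intro exI[of _ "ennreal \<epsilon>"]) auto
  qed
  then show ?thesis
    using I hor by (auto simp: geodesic_on_def projected_line_piecewise_C1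
        shape_length_projected_line)
qed

section \<open>Planes through the origin\<close>
text \<open>
  The parameter \<open>\<phi>\<close> need not be differentiable, and only the velocity \<open>u\<close> of the composite curve
  is given. If \<open>Z \<noteq> 0\<close>, then the projected line has a nonzero velocity \<open>U\<close>, from which the
  derivative of \<open>\<phi>\<close> can be recovered, so \<open>u\<close> is a multiple of \<open>U\<close>. If \<open>Z = 0\<close>, then the curve
  stays on the ray through \<open>W\<close>, and \<open>u\<close> is a multiple of \<open>W\<close>; here \<open>\<phi>\<close> behaves like a square
  root. In both cases the multiple is not zero.
\<close>

lemma projected_line_in_plane:
  assumes I: "is_interval I" "a \<in> I" "I \<subseteq> {a..}"
    and \<phi>: "continuous_on I \<phi>" "\<phi> a = 0" and hor: "Im (herm Z V) = 0" and V: "V \<noteq> 0"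
    and \<gamma>: "\<And>t. t \<in> I \<Longrightarrow> \<gamma> t = rot_map (Z + \<phi> t *\<^sub>R V)"
    and d: "(\<gamma> has_vector_derivative u) (at a within I)" and u: "u \<noteq> 0" "n \<bullet> u = 0"
    and start: "n \<bullet> \<gamma> a = 0" and t: "t \<in> I"
  shows "n \<bullet> \<gamma> t = 0"
proof (cases "t = a")
  case False
  then have "a < t" using t I(3) by force
  have "{a..t} \<subseteq> I"
    by (rule connected_contains_Icc[OF is_interval_connected[OF I(1)] I(2) t])
  then have nontriv: "at a within I \<noteq> bot"
    using \<open>a < t\<close> islimpt_subset[of a "{a..t}" I] islimpt_Icc[of a t a]
    by (simp add: trivial_limit_within)
  define P U W where "P = rot_map Z" and "U = rot_polar Z V" and "W = rot_map V"
  have \<gamma>_eq: "\<gamma> t = P + \<phi> t *\<^sub>R U + (\<phi> t)\<^sup>2 *\<^sub>R W" if "t \<in> I" for t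
    using \<gamma>[OF that] by (simp add: rot_map_line P_def U_def W_def)
  have \<gamma>a: "\<gamma> a = P" using \<gamma>_eq[OF I(2)] \<phi>(2) by simp
  have \<phi>0: "(\<phi> \<longlongrightarrow> 0) (at a within I)"
    using \<phi> I(2) unfolding continuous_on_def by metis
  have quot: "((\<lambda>y. \<phi> y / (y - a) * (x \<bullet> U + \<phi> y * (x \<bullet> W))) \<longlongrightarrow> x \<bullet> u) (at a within I)" for x
  proof -
    have "((\<lambda>t. x \<bullet> \<gamma> t) has_vector_derivative x \<bullet> u) (at a within I)"
      by (rule bounded_linear.has_vector_derivative[OF bounded_linear_inner_right d])
    then have "((\<lambda>y. (x \<bullet> \<gamma> y - x \<bullet> \<gamma> a) / (y - a)) \<longlongrightarrow> x \<bullet> u) (at a within I)"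
      unfolding has_real_derivative_iff_has_vector_derivative[symmetric] has_field_derivative_iff .
    then show ?thesis
    proof (rule Lim_transform_eventually)
      show "\<forall>\<^sub>F y in at a within I. (x \<bullet> \<gamma> y - x \<bullet> \<gamma> a) / (y - a) = \<phi> y / (y - a) * (x \<bullet> U + \<phi> y *
          (x \<bullet> W))"
        unfolding eventually_at_filter
        by (rule always_eventually) (auto simp: \<gamma>_eq \<gamma>a inner_add_right power2_eq_square
            algebra_simps add_divide_distrib)
    qed
  qed
  have nP: "n \<bullet> P = 0" using start \<gamma>a by simp
  have "n \<bullet> U = 0 \<and> n \<bullet> W = 0"
  proof (cases "Z = 0")
    case True
    then have U: "U = 0" by (simp add: U_def rot_polar_def vec_eq_iff forall_3)
    \<comment> \<open>Both limits below are limits of \<open>\<phi>\<^sup>2 / (y - a)\<close> times \<open>(u \<bullet> W) (n \<bullet> W)\<close>.\<close>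
    have "((\<lambda>y. (\<phi> y / (y - a) * (u \<bullet> U + \<phi> y * (u \<bullet> W))) * (n \<bullet> W))
        \<longlongrightarrow> (u \<bullet> u) * (n \<bullet> W)) (at a within I)"
      by (intro tendsto_intros quot)
    moreover have "((\<lambda>y. (\<phi> y / (y - a) * (n \<bullet> U + \<phi> y * (n \<bullet> W))) * (u \<bullet> W))
        \<longlongrightarrow> (n \<bullet> u) * (u \<bullet> W)) (at a within I)"
      by (intro tendsto_intros quot)
    then have "((\<lambda>y. (\<phi> y / (y - a) * (u \<bullet> U + \<phi> y * (u \<bullet> W))) * (n \<bullet> W)) \<longlongrightarrow> 0) (at a within I)"
      by (simp add: U u(2) mult_ac)
    ultimately have "(u \<bullet> u) * (n \<bullet> W) = 0" by (rule tendsto_unique[OF nontriv])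
    with u(1) U show ?thesis by simp
  next
    case False
    have "norm U = norm Z * norm V" unfolding U_def by (rule norm_rot_polar[OF hor])
    then have U: "U \<noteq> 0" using False V by auto
    define \<kappa> where "\<kappa> = (U \<bullet> u) / (U \<bullet> U)"
    have den: "((\<lambda>y. x \<bullet> U + \<phi> y * (x \<bullet> W)) \<longlongrightarrow> x \<bullet> U) (at a within I)" for x
      by (auto intro!: tendsto_eq_intros \<phi>0)
    have "((\<lambda>y. (\<phi> y / (y - a) * (U \<bullet> U + \<phi> y * (U \<bullet> W))) / (U \<bullet> U + \<phi> y * (U \<bullet> W)))
        \<longlongrightarrow> \<kappa>) (at a within I)"
      unfolding \<kappa>_def using U by (intro tendsto_divide quot den) simp
    moreover have "\<forall>\<^sub>F y in at a within I. U \<bullet> U + \<phi> y * (U \<bullet> W) \<noteq> 0"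
      using U by (intro tendsto_imp_eventually_ne[OF den]) simp
    then have "\<forall>\<^sub>F y in at a within I. (\<phi> y / (y - a) * (U \<bullet> U + \<phi> y * (U \<bullet> W))) / (U \<bullet> U + \<phi> y * (U
        \<bullet> W)) = \<phi> y / (y - a)"
      by eventually_elim simp
    ultimately have \<kappa>: "((\<lambda>y. \<phi> y / (y - a)) \<longlongrightarrow> \<kappa>) (at a within I)"
      by (rule Lim_transform_eventually)
    have lim: "\<kappa> * (x \<bullet> U) = x \<bullet> u" for x
      using tendsto_unique[OF nontriv tendsto_mult[OF \<kappa> den] quot] .
    have "\<kappa> \<noteq> 0" using lim[of u] u(1) by auto
    then have nU: "n \<bullet> U = 0" using lim[of n] u(2) by simp
    have "n \<bullet> ((norm Z)\<^sup>2 *\<^sub>R W + (norm V)\<^sup>2 *\<^sub>R P) = n \<bullet> (Re (herm Z V) *\<^sub>R U)"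
      unfolding W_def P_def U_def rot_map_coplanar[OF hor] ..
    then have "n \<bullet> W = 0" using nU nP False by (simp add: inner_add_right)
    with nU show ?thesis ..
  qed
  then show ?thesis using \<gamma>_eq[OF t] nP by (simp add: inner_add_right)
qed (use start in simp)

lemma origin_plane_eq: "w \<in> origin_plane A B C \<longleftrightarrow> vector [A, B, C] \<bullet> w = 0"
  by (simp add: origin_plane_def inner_vec_def sum_3)

lemma geodesic_stays_in_plane:
  assumes geo: "geodesic_on I \<gamma>" and I: "a \<in> I" "I \<subseteq> {a..}"
    and start: "\<gamma> a \<in> origin_plane A B C"
    and d: "(\<gamma> has_vector_derivative u) (at a within I)" "u \<noteq> 0" "u \<in> origin_plane A B C"
    and t: "t \<in> I"
  shows "\<gamma> t \<in> origin_plane A B C"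
proof -
  obtain Z V \<phi> where V: "V \<noteq> 0" and hor: "Im (herm Z V) = 0" and \<phi>: "continuous_on I \<phi>"
    and \<gamma>: "\<And>t. t \<in> I \<Longrightarrow> \<gamma> t = rot_map (Z + \<phi> t *\<^sub>R V)"
    using geodesic_is_projected_line[OF geo] by blast
  have "is_interval I" using geo by (simp add: geodesic_on_def)
  then show ?thesis
    unfolding origin_plane_eq
  proof (rule projected_line_in_plane[where \<phi> = "\<lambda>t. \<phi> t - \<phi> a" and Z = "Z + \<phi> a *\<^sub>R V" and V = V
      and I = I and a = a and u = u])
    show "continuous_on I (\<lambda>t. \<phi> t - \<phi> a)" by (intro continuous_intros \<phi>)
    show "Im (herm (Z + \<phi> a *\<^sub>R V) V) = 0" using hor by (simp add: herm_add_left herm_scale_left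
        herm_self)
    show "\<gamma> t = rot_map (Z + \<phi> a *\<^sub>R V + (\<phi> t - \<phi> a) *\<^sub>R V)" if "t \<in> I" for t
      using \<gamma>[OF that] by (simp add: algebra_simps)
  qed (use I V d t start in \<open>auto simp: origin_plane_eq\<close>)
qed

lemma polar_metric:
  assumes e: "norm e1 = 1" "norm e2 = 1" "e1 \<bullet> e2 = 0" and r: "r > 0"
  shows "\<exists>D. ((\<lambda>(r, \<theta>). plane_polar e1 e2 (r\<^sup>2 / 2) \<theta>) has_derivative D) (at (r, \<theta>)) \<and>
    (\<forall>dr d\<theta>. shape_metric (plane_polar e1 e2 (r\<^sup>2 / 2) \<theta>) (D (dr, d\<theta>)) = dr\<^sup>2 + r\<^sup>2 * d\<theta>\<^sup>2 / 4)"
proof -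
  have ee: "e1 \<bullet> e1 = 1" "e2 \<bullet> e2 = 1" "e2 \<bullet> e1 = 0"
    using e by (simp_all add: norm_eq_1 inner_commute)
  have norm_sq: "(norm (a *\<^sub>R e1 + b *\<^sub>R e2))\<^sup>2 = a\<^sup>2 + b\<^sup>2" for a b
    unfolding power2_norm_eq_inner by (simp add: inner_add_left inner_add_right ee e
        power2_eq_square)
  have norm_w: "norm (plane_polar e1 e2 (r\<^sup>2 / 2) \<theta>) = r\<^sup>2 / 2"
  proof (rule power2_eq_imp_eq)
    have "plane_polar e1 e2 (r\<^sup>2 / 2) \<theta> = (r\<^sup>2 / 2 * cos \<theta>) *\<^sub>R e1 + (r\<^sup>2 / 2 * sin \<theta>) *\<^sub>R e2"
      by (simp add: plane_polar_def scaleR_add_right)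
    then show "(norm (plane_polar e1 e2 (r\<^sup>2 / 2) \<theta>))\<^sup>2 = (r\<^sup>2 / 2)\<^sup>2"
      by (simp only: norm_sq power_mult_distrib distrib_left[symmetric] sin_cos_squared_add2
          mult_1_right)
  qed simp_all
  define D where "D = (\<lambda>(dr, d\<theta>). (r * cos \<theta> * dr - r\<^sup>2 / 2 * sin \<theta> * d\<theta>) *\<^sub>R e1
       + (r * sin \<theta> * dr + r\<^sup>2 / 2 * cos \<theta> * d\<theta>) *\<^sub>R e2)"
  have norm_D: "(norm (D (dr, d\<theta>)))\<^sup>2 = r\<^sup>2 * (dr\<^sup>2 + r\<^sup>2 * d\<theta>\<^sup>2 / 4)" for dr d\<theta>
  proof -
    have "(norm (D (dr, d\<theta>)))\<^sup>2 = (r * cos \<theta> * dr - r\<^sup>2 / 2 * sin \<theta> * d\<theta>)\<^sup>2 + (r * sin \<theta> * dr + r\<^sup>2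
        / 2 * cos \<theta> * d\<theta>)\<^sup>2"
      unfolding D_def prod.case by (rule norm_sq)
    also have "\<dots> = ((sin \<theta>)\<^sup>2 + (cos \<theta>)\<^sup>2) * (r\<^sup>2 * dr\<^sup>2 + r\<^sup>2 * r\<^sup>2 * d\<theta>\<^sup>2 / 4)"
      by (simp add: power2_eq_square algebra_simps
          del: sin_cos_squared_add sin_cos_squared_add2 sin_cos_squared_add3)
    finally show ?thesis by (simp only: sin_cos_squared_add) (simp add: algebra_simps)
  qed
  have "shape_metric (plane_polar e1 e2 (r\<^sup>2 / 2) \<theta>) (D (dr, d\<theta>)) = dr\<^sup>2 + r\<^sup>2 * d\<theta>\<^sup>2 / 4" for dr d\<theta>
    unfolding shape_metric_def norm_w norm_D using r by simp
  moreover have "((\<lambda>(r, \<theta>). plane_polar e1 e2 (r\<^sup>2 / 2) \<theta>) has_derivative D) (at (r, \<theta>))"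
    unfolding plane_polar_def case_prod_beta D_def
    by (auto intro!: derivative_eq_intros simp: algebra_simps add_divide_distrib
        diff_divide_distrib)
  ultimately show ?thesis by blast
qed

theorem theorem3:
  fixes m :: "real ^ 3"
  assumes "m $ 1 > 0" "m $ 2 > 0" "m $ 3 > 0"
  shows
    "(\<forall>q q'. riemannian_distance (shape_map m q) (shape_map m q') = ennreal (shape_distance m q q'))
   \<and> ((\<forall>I \<gamma>. geodesic_on I \<gamma> \<longrightarrow>
          (\<exists>q v \<phi>. horizontal_line m q v \<and> continuous_on I \<phi> \<and> mono_on I \<phi> \<and>
             (\<forall>t\<in>I. \<gamma> t = shape_map m (q + \<phi> t *\<^sub>R v))))
      \<and> (\<forall>I q v. is_interval I \<and> horizontal_line m q v \<and>
             (\<forall>t\<in>interior I. shape_map m (q + t *\<^sub>R v) \<noteq> 0) \<longrightarrow>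
          geodesic_on I (\<lambda>t. shape_map m (q + t *\<^sub>R v))))
   \<and> (\<forall>A B C. (A, B, C) \<noteq> (0, 0, 0) \<longrightarrow>
        (\<forall>I \<gamma> a u. geodesic_on I \<gamma> \<and> a \<in> I \<and> I \<subseteq> {a..} \<and>
             \<gamma> a \<in> origin_plane A B C \<and>
             (\<gamma> has_vector_derivative u) (at a within I) \<and> u \<noteq> 0 \<and> u \<in> origin_plane A B C \<longrightarrow>
           (\<forall>t\<in>I. \<gamma> t \<in> origin_plane A B C)))
   \<and> (\<forall>A B C. (A, B, C) \<noteq> (0, 0, 0) \<longrightarrow>
        (\<forall>e1\<in>origin_plane A B C. \<forall>e2\<in>origin_plane A B C.
           norm e1 = 1 \<and> norm e2 = 1 \<and> e1 \<bullet> e2 = 0 \<longrightarrow>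
           (\<forall>r>0. \<forall>\<theta>. \<exists>D.
              ((\<lambda>(r, \<theta>). plane_polar e1 e2 (r\<^sup>2 / 2) \<theta>) has_derivative D) (at (r, \<theta>)) \<and>
              (\<forall>dr d\<theta>. shape_metric (plane_polar e1 e2 (r\<^sup>2 / 2) \<theta>) (D (dr, d\<theta>))
                         = dr\<^sup>2 + r\<^sup>2 * d\<theta>\<^sup>2 / 4))))"
proof (intro conjI allI impI ballI)
  fix q q'
  show "riemannian_distance (shape_map m q) (shape_map m q') = ennreal (shape_distance m q q')"
    by (simp add: riemannian_distance_eq shape_distance_eq[OF assms])
next
  fix I \<gamma> assume "geodesic_on I \<gamma>"
  then obtain Z V \<phi> where ZV: "V \<noteq> 0" "Im (herm Z V) = 0" and \<phi>: "continuous_on I \<phi>" "mono_on I \<phi>"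
    "\<And>t. t \<in> I \<Longrightarrow> \<gamma> t = rot_map (Z + \<phi> t *\<^sub>R V)"
    using geodesic_is_projected_line by blast
  obtain q v where "horizontal_line m q v" "jacobi_map m q = Z" "jacobi_map m v = V"
    using ex_horizontal_line[OF assms ZV] by blast
  with \<phi> show "\<exists>q v \<phi>. horizontal_line m q v \<and> continuous_on I \<phi> \<and> mono_on I \<phi> \<and>
      (\<forall>t\<in>I. \<gamma> t = shape_map m (q + \<phi> t *\<^sub>R v))"
    by (intro exI[of _ q] exI[of _ v] exI[of _ \<phi>]) (simp add: shape_map_eq jacobi_map_line)
next
  fix I q v
  assume *: "is_interval I \<and> horizontal_line m q v \<and> (\<forall>t\<in>interior I. shape_map m (q + t *\<^sub>R v) \<noteq> 0)"
  then have "geodesic_on I (\<lambda>t. rot_map (jacobi_map m q + t *\<^sub>R jacobi_map m v))"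
    using horizontal_lineD[OF assms]
    by (intro projected_line_is_geodesic) (auto simp: shape_map_eq jacobi_map_line rot_map_eq_0_iff)
  then show "geodesic_on I (\<lambda>t. shape_map m (q + t *\<^sub>R v))"
    by (simp add: shape_map_eq jacobi_map_line)
next
  fix A B C I \<gamma> a u t
  assume "geodesic_on I \<gamma> \<and> a \<in> I \<and> I \<subseteq> {a..} \<and> \<gamma> a \<in> origin_plane A B C \<and>
      (\<gamma> has_vector_derivative u) (at a within I) \<and> u \<noteq> 0 \<and> u \<in> origin_plane A B C" "t \<in> I"
  then show "\<gamma> t \<in> origin_plane A B C" using geodesic_stays_in_plane by blast
next
  fix A B C r \<theta> :: real and e1 e2 :: "real ^ 3"
  assume "norm e1 = 1 \<and> norm e2 = 1 \<and> e1 \<bullet> e2 = 0" "r > 0"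
  then show "\<exists>D. ((\<lambda>(r, \<theta>). plane_polar e1 e2 (r\<^sup>2 / 2) \<theta>) has_derivative D) (at (r, \<theta>)) \<and>
      (\<forall>dr d\<theta>. shape_metric (plane_polar e1 e2 (r\<^sup>2 / 2) \<theta>) (D (dr, d\<theta>)) = dr\<^sup>2 + r\<^sup>2 * d\<theta>\<^sup>2 / 4)"
    using polar_metric by blast
qed

end
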